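(* The punctured Nordstrom-Robinson code $\mathcal{PN}$ is $\mathrm{Aut}(\mathcal{PN})$-completely transitive, i.e. each part $\mathcal{PN}_i$ of its distance partition is an orbit of $\mathrm{Aut}(\mathcal{PN})$.
   Context: $\Gamma_{15}$ is the binary Hamming graph on $\mathbb{F}_2^{15}$; $\mathrm{Aut}(\Gamma_{15})=T\rtimes L$, with $T$ the translations of $\mathbb{F}_2^{15}$ and $L\cong S_{15}$ the coordinate permutations. For a code $C\subseteq\mathbb{F}_2^{15}$, $\mathrm{Aut}(C)$ is its setwise stabiliser in $\mathrm{Aut}(\Gamma_{15})$; with $d(\gamma,C)$ the Hamming distance from $\gamma$ to the nearest codeword and $\rho$ the covering radius, $C_i=\{\gamma:d(\gamma,C)=i\}$ for $0\le i\le\rho$ form the distance partition. $C$ is $X$-completely transitive if each $C_i$ is an $X$-orbit. Nordstrom-Robinson code: let $\mathcal{G}$ be the $[24,12,8]$ extended binary Golay code in $\mathbb{F}_2^{24}$ with $(1^8,0^{16})\in\mathcal{G}$; let $J^*=\{1,\dots,8\}$, $J=\{9,\dots,24\}$, $\mathcal{D}^0=\{\alpha\in\mathcal{G}:\mathrm{supp}(\alpha)\cap J^*=\emptyset\}$ and $\mathcal{D}^i=\{\alpha\in\mathcal{G}:\mathrm{supp}(\alpha)\cap J^*=\{i,8\}\}$ for $1\le i\le7$. Then $\mathcal{NR}\subseteq\mathbb{F}_2^{16}$ is the set of restrictions to $J$ of the vectors in $\bigcup_{i=0}^7\mathcal{D}^i$. The punctured Nordstrom-Robinson code $\mathcal{PN}\subseteq\mathbb{F}_2^{15}$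 is obtained by deleting the first coordinate from every codeword of $\mathcal{NR}$. *)

theory Defs
  imports "HOL-Combinatorics.Permutations"
begin

text \<open>Vectors of F_2^n are represented by their supports, i.e. subsets of the
coordinate set {1..n}; vector addition is symmetric difference.\<close>

definition vecs :: "nat \<Rightarrow> nat set set" where
  "vecs n = Pow {1..n}"

definition vadd :: "nat set \<Rightarrow> nat set \<Rightarrow> nat set" where
  "vadd x y = (x - y) \<union> (y - x)"

definition hdist :: "nat set \<Rightarrow> nat set \<Rightarrow> nat" where
  "hdist x y = card (vadd x y)"

definition linear_code :: "nat \<Rightarrow> nat set set \<Rightarrow> bool" where
  "linear_code n C \<longleftrightarrow> C \<subseteq> vecs n \<and> {} \<in> C \<and> (\<forall>x\<in>C. \<forall>y\<in>C. vadd x y \<in> C)"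

definition golay_with_octad :: "nat set set \<Rightarrow> bool" where
  "golay_with_octad G \<longleftrightarrow> linear_code 24 G \<and> card G = 2 ^ 12
     \<and> Min (card ` (G - {{}})) = 8 \<and> {1..8} \<in> G"

definition D :: "nat set set \<Rightarrow> nat \<Rightarrow> nat set set" where
  "D G i = (if i = 0 then {\<alpha> \<in> G. \<alpha> \<inter> {1..8} = {}}
            else {\<alpha> \<in> G. \<alpha> \<inter> {1..8} = {i, 8}})"

definition NR :: "nat set set \<Rightarrow> nat set set" where
  "NR G = {(\<lambda>j. j - 8) ` (\<alpha> \<inter> {9..24}) | \<alpha>. \<alpha> \<in> (\<Union>i\<in>{0..7}. D G i)}"

definition PN :: "nat set set \<Rightarrow> nat set set" where
  "PN G = {(\<lambda>j. j - 1) ` (\<beta> - {1}) | \<beta>. \<beta> \<in> NR G}"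

definition dist_to_code :: "nat set set \<Rightarrow> nat set \<Rightarrow> nat" where
  "dist_to_code C \<gamma> = Min (hdist \<gamma> ` C)"

definition covering_radius :: "nat \<Rightarrow> nat set set \<Rightarrow> nat" where
  "covering_radius n C = Max (dist_to_code C ` vecs n)"

definition dist_part :: "nat \<Rightarrow> nat set set \<Rightarrow> nat \<Rightarrow> nat set set" where
  "dist_part n C i = {\<gamma> \<in> vecs n. dist_to_code C \<gamma> = i}"

definition aut_act :: "(nat \<Rightarrow> nat) \<times> nat set \<Rightarrow> nat set \<Rightarrow> nat set" where
  "aut_act g x = vadd (fst g ` x) (snd g)"

definition Aut_Hamming :: "nat \<Rightarrow> ((nat \<Rightarrow> nat) \<times> nat set) set" where
  "Aut_Hamming n = {(\<sigma>, t). \<sigma> permutes {1..n} \<and> t \<in> vecs n}"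

definition Aut_code :: "nat \<Rightarrow> nat set set \<Rightarrow> ((nat \<Rightarrow> nat) \<times> nat set) set" where
  "Aut_code n C = {g \<in> Aut_Hamming n. aut_act g ` C = C}"

definition orbit_of :: "((nat \<Rightarrow> nat) \<times> nat set) set \<Rightarrow> nat set \<Rightarrow> nat set set" where
  "orbit_of X \<gamma> = (\<lambda>g. aut_act g \<gamma>) ` X"

definition completely_transitive ::
  "nat \<Rightarrow> ((nat \<Rightarrow> nat) \<times> nat set) set \<Rightarrow> nat set set \<Rightarrow> bool" where
  "completely_transitive n X C \<longleftrightarrow>
     (\<forall>i \<le> covering_radius n C. \<exists>\<gamma> \<in> vecs n. dist_part n C i = orbit_of X \<gamma>)"

end

theory Submission
  imports Defs
begin

text \<open>
  Translating the code by one of its words amounts to interchanging the coordinates \<open>i\<close> and \<open>8\<close> of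
  the Golay code, so it suffices to compare vectors at distance \<open>i\<close> whose nearest codeword is \<open>0\<close>,
  for two possibly different Golay codes. Sphere packing makes the Golay code a Steiner system and
  then doubly even and self-dual. Hence the words disjoint from the fixed octad form the
  Reed-Muller code \<open>RM(1,4)\<close> in suitable coordinates of \<open>F_2^4\<close>, the deleted coordinate being the
  origin and any two given points being \<open>e1\<close> and \<open>e2\<close>. The seven remaining cosets are quadratic
  forms whose alternating forms, and their pairwise differences, are nonsingular. Such a
  Kerdock set is unique up to linear maps fixing \<open>e1\<close> and \<open>e2\<close>, so all these codes coincide in suitable
  coordinates. Every point other than \<open>e1 + e2\<close> lies in a word of weight 5 containing \<open>e1\<close> and \<open>e2\<close>,
  so a vector of weight at least 3 that has \<open>0\<close> as nearest codeword is \<open>{e1, e2, e1 + e2}\<close>.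
\<close>

section \<open>Symmetric differences\<close>

text \<open>The hypothesis gives only the parameters of the Golay code and one octad, so its
  structure has to come from counting alone. The obstacle is that the Nordstrom-Robinson code is not
  linear: translation by one of its words need not preserve it, which is why the statements range
  over arbitrary Golay codes. No automorphism group is ever described. Instead \<open>PN\<close> of
  every Golay code is mapped onto one fixed model, and an automorphism arises by following one such
  coordinate map with the inverse of another, up to translations by codewords. The freedom to
  prescribe the places of two coordinates settles vectors of weight up to 2; the words of weight 5
  then leave a single place for a third point and none for a fourth. The covering radius is never
  computed: it is enough that every part up to it is nonempty.\<close>

lemma vadd_iff [simp]: "x \<in> vadd A B \<longleftrightarrow> (x \<in> A) \<noteq> (x \<in> B)"
  by (auto simp: vadd_def)

lemma vadd_self [simp]: "vadd A A = {}"
  and vadd_empty [simp]: "vadd A {} = A" "vadd {} A = A"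
  and vadd_cancel [simp]: "vadd A (vadd A B) = B" "vadd (vadd B A) A = B"
  by auto

lemma vadd_commute: "vadd A B = vadd B A"
  and vadd_assoc: "vadd (vadd A B) C = vadd A (vadd B C)"
  by auto

lemma vadd_eq_empty_iff [simp]: "vadd A B = {} \<longleftrightarrow> A = B"
  by auto

lemma vadd_Int: "vadd A B \<inter> C = vadd (A \<inter> C) (B \<inter> C)"
  by auto

lemma image_vadd:
  assumes "inj_on f S" "A \<subseteq> S" "B \<subseteq> S"
  shows "f ` vadd A B = vadd (f ` A) (f ` B)"
  using assms unfolding vadd_def inj_on_def by blast

lemma finite_vadd [simp, intro]: "finite A \<Longrightarrow> finite B \<Longrightarrow> finite (vadd A B)"
  by (simp add: vadd_def)

lemma card_vadd:
  assumes "finite A" "finite B"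
  shows "card (vadd A B) + 2 * card (A \<inter> B) = card A + card B"
proof -
  have "card (vadd A B) = card (A - B) + card (B - A)"
    unfolding vadd_def using assms by (intro card_Un_disjoint) auto
  moreover have "card A = card (A - B) + card (A \<inter> B)"
    using assms by (metis card_Int_Diff add.commute)
  moreover have "card B = card (B - A) + card (A \<inter> B)"
    using assms by (metis card_Int_Diff add.commute Int_commute)
  ultimately show ?thesis by simp
qed

lemma card_vadd_le:
  assumes "finite A" "finite B"
  shows "card (vadd A B) \<le> card A + card B"
  using card_vadd[OF assms] by simp

lemma even_card_vadd:
  assumes "finite A" "finite B"
  shows "even (card (vadd A B)) \<longleftrightarrow> (even (card A) \<longleftrightarrow> even (card B))"
  using card_vadd[OF assms] by presburger

section \<open>Self-duality of the Golay code\<close>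

locale golay =
  fixes G :: "nat set set"
  assumes golay: "golay_with_octad G"
begin

lemma subset_word: "\<alpha> \<in> G \<Longrightarrow> \<alpha> \<subseteq> {1..24}"
  and empty_word: "{} \<in> G"
  and vadd_word: "\<alpha> \<in> G \<Longrightarrow> \<beta> \<in> G \<Longrightarrow> vadd \<alpha> \<beta> \<in> G"
  and card_code: "card G = 4096"
  and octad_word: "{1..8} \<in> G"
  using golay by (auto simp: golay_with_octad_def linear_code_def vecs_def)

lemma finite_code: "finite G"
  using card_code card.infinite by fastforce

lemma finite_word: "\<alpha> \<in> G \<Longrightarrow> finite \<alpha>"
  using subset_word finite_subset by blast

lemma min_weight:
  assumes "\<alpha> \<in> G" "\<alpha> \<noteq> {}"
  shows "8 \<le> card \<alpha>"
proof -
  have "Min (card ` (G - {{}})) \<le> card \<alpha>"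
    using assms finite_code by (intro Min_le) auto
  then show ?thesis using golay by (simp add: golay_with_octad_def)
qed

text \<open>Puncturing at \<open>x\<close> gives a perfect code: the balls of radius 3 have
  \<open>2048 = 2 ^ 11\<close> elements and are pairwise disjoint.\<close>

lemma covering:
  assumes x: "x \<in> {1..24}" and v: "v \<subseteq> {1..24} - {x}"
  shows "\<exists>\<alpha>\<in>G. card (vadd v \<alpha> - {x}) \<le> 3"
proof -
  let ?N = "{1..24::nat} - {x}"
  define B where "B = {w. w \<subseteq> ?N \<and> card w \<le> 3}"
  have finB: "finite B" unfolding B_def by (rule finite_subset[of _ "Pow ?N"]) auto
  have cN: "card ?N = 23" using x by simp
  have "B = (\<Union>k\<in>{0,1,2,3}. {w. w \<subseteq> ?N \<and> card w = k})"
    unfolding B_def by auto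
  then have "card B = (\<Sum>k\<in>{0,1,2,3}. card {w. w \<subseteq> ?N \<and> card w = k})"
    by (simp only:) (intro card_UN_disjoint; auto)
  also have "\<dots> = (\<Sum>k\<in>{0,1,2,3}. 23 choose k)"
    by (intro sum.cong refl) (simp add: n_subsets cN del: One_nat_def)
  also have "\<dots> = 2048" by (simp add: binomial_fact numeral_eq_Suc)
  finally have cB: "card B = 2048" .
  define h where "h = (\<lambda>(\<alpha>, w). vadd (\<alpha> - {x}) w)"
  have inj: "inj_on h (G \<times> B)"
  proof (intro inj_onI, clarsimp simp: h_def)
    fix \<alpha> w \<beta> w' assume a: "\<alpha> \<in> G" "\<beta> \<in> G" "w \<in> B" "w' \<in> B"
      and eq: "vadd (\<alpha> - {x}) w = vadd (\<beta> - {x}) w'"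
    have f: "finite w" "finite w'" "card w \<le> 3" "card w' \<le> 3"
      using a finite_subset by (auto simp: B_def)
    \<comment> \<open>Off \<open>x\<close> the two words differ only inside
      \<open>vadd w w'\<close>, at most 6 places; the punctured coordinate adds at most one more,
      which stays below the minimum weight 8.\<close>
    have "vadd \<alpha> \<beta> \<subseteq> insert x (vadd w w')" 
    proof
      fix y assume "y \<in> vadd \<alpha> \<beta>"
      then show "y \<in> insert x (vadd w w')" using arg_cong[OF eq, of "\<lambda>S. y \<in> S"] by auto
    qed
    then have "card (vadd \<alpha> \<beta>) \<le> card (insert x (vadd w w'))"
      using f by (intro card_mono) auto
    also have "\<dots> \<le> 7" using card_vadd_le[of w w'] f by (simp add: card_insert_if)
    finally have "\<alpha> = \<beta>" using min_weight[OF vadd_word[OF a(1,2)]] by fastforce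
    moreover have "w = w'" using eq unfolding \<open>\<alpha> = \<beta>\<close> by (metis vadd_cancel(1))
    ultimately show "\<alpha> = \<beta> \<and> w = w'" ..
  qed
  have sub: "h ` (G \<times> B) \<subseteq> Pow ?N"
    using subset_word by (force simp: h_def B_def)
  have "card (h ` (G \<times> B)) = card (Pow ?N)"
    using card_image[OF inj] by (simp only: card_cartesian_product card_Pow cB card_code cN finite_Diff finite_atLeastAtMost) simp
  then have "h ` (G \<times> B) = Pow ?N" using sub by (intro card_subset_eq) auto
  then have "v \<in> h ` (G \<times> B)" using v by blast
  then obtain \<alpha> w where a: "\<alpha> \<in> G" "w \<in> B" "v = vadd (\<alpha> - {x}) w"
    by (auto simp: h_def)
  then have "vadd v \<alpha> - {x} \<subseteq> w" by auto
  moreover have "finite w" "card w \<le> 3" using a finite_subset by (auto simp: B_def)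
  ultimately have "card (vadd v \<alpha> - {x}) \<le> 3" using card_mono le_trans by metis
  then show ?thesis using a by blast
qed

section \<open>Octads as the blocks of a Steiner system S(5,8,24)\<close>

definition octads :: "nat set set" where
  "octads = {\<alpha> \<in> G. card \<alpha> = 8}"

text \<open>The sum of two distinct octads has weight 16 minus twice their intersection, and at
  least 8.\<close>

lemma octad_inter_le:
  assumes "A \<in> octads" "B \<in> octads" "A \<noteq> B"
  shows "card (A \<inter> B) \<le> 4"
  using assms card_vadd[of A B] min_weight[of "vadd A B"] vadd_word finite_word
  by (fastforce simp: octads_def)

text \<open>Puncture at a point x of \<open>S\<close>. A word within distance 3 of the other four
  points is nonzero, so it has at least 7 points off x. Since 7 = 4 + 3, it has exactly 7 there and
  contains the four points; minimum weight 8 then forces x into it.\<close>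

lemma octad_through:
  assumes S: "S \<subseteq> {1..24}" "card S = 5"
  shows "\<exists>B\<in>octads. S \<subseteq> B"
proof -
  obtain x where x: "x \<in> S" using S by fastforce
  let ?v = "S - {x}"
  have fS: "finite S" using S finite_subset by blast
  have cv: "card ?v = 4" using S x fS by simp
  obtain \<alpha> where a: "\<alpha> \<in> G" "card (vadd ?v \<alpha> - {x}) \<le> 3"
    using covering[of x ?v] S x by blast
  have fa: "finite \<alpha>" using a finite_word by blast
  have eq: "vadd ?v \<alpha> - {x} = vadd ?v (\<alpha> - {x})" using x by auto
  have c: "card (vadd ?v (\<alpha> - {x})) + 2 * card (?v \<inter> (\<alpha> - {x})) = 4 + card (\<alpha> - {x})"
    using card_vadd[of ?v "\<alpha> - {x}"] fS fa cv by simp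
  have le: "card (?v \<inter> (\<alpha> - {x})) \<le> 4" using cv card_mono[of ?v] fS by (metis Int_lower1 finite_Diff)
  have "\<alpha> \<noteq> {}" using a(2) cv by auto
  then have "8 \<le> card \<alpha>" using min_weight a by blast
  then have ge: "7 \<le> card (\<alpha> - {x})" by (auto simp: card_Diff_singleton_if)
  have 7: "card (\<alpha> - {x}) = 7" using c le a(2) ge unfolding eq by linarith
  then have "x \<in> \<alpha>" "card \<alpha> = 8"
    using \<open>8 \<le> card \<alpha>\<close> by (auto simp: card_Diff_singleton_if split: if_splits)
  moreover have "card (?v \<inter> (\<alpha> - {x})) = 4" using c le a(2) 7 unfolding eq by linarith
  then have "?v \<inter> (\<alpha> - {x}) = ?v" using cv fS by (intro card_subset_eq) auto
  ultimately show ?thesis using a by (intro bexI[of _ \<alpha>]) (auto simp: octads_def)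
qed

lemma octad_unique:
  assumes "A \<in> octads" "B \<in> octads" "S \<subseteq> A" "S \<subseteq> B" "card S = 5"
  shows "A = B"
proof (rule ccontr)
  assume "A \<noteq> B"
  then have "card (A \<inter> B) \<le> 4" using octad_inter_le assms by blast
  moreover have "card S \<le> card (A \<inter> B)"
    using assms by (intro card_mono) (auto simp: octads_def finite_word)
  ultimately show False using assms by simp
qed

text \<open>Add a point of \<open>B - A\<close> to the three common points to get a tetrad
  \<open>T\<close>. Each of the five points x of \<open>A - B\<close> spans with \<open>T\<close> an
  octad \<open>P x\<close>. These octads are distinct because they meet \<open>A\<close>
  differently, and octads through \<open>T\<close> share nothing else, so the sets
  \<open>P x - T\<close> would be five disjoint tetrads among the 16 points off
  \<open>B\<close>.\<close>

lemma octad_inter_ne_3: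
  assumes A: "A \<in> octads" and B: "B \<in> octads"
  shows "card (A \<inter> B) \<noteq> 3"
proof
  assume c3: "card (A \<inter> B) = 3"
  have fin: "finite A" "finite B" and c8: "card A = 8" "card B = 8"
    and sub: "A \<subseteq> {1..24}" "B \<subseteq> {1..24}"
    using A B finite_word subset_word by (auto simp: octads_def)
  have AB: "card (A - B) = 5" "card (B - A) = 5"
    using c3 c8 fin by (auto simp: card_Diff_subset_Int Int_commute)
  then have "B - A \<noteq> {}" by force
  then obtain t where t: "t \<in> B" "t \<notin> A" by blast
  define T where "T = insert t (A \<inter> B)"
  have cT: "card T = 4" "finite T" "T \<subseteq> B" using t c3 fin by (auto simp: T_def)
  have "\<exists>P\<in>octads. insert x T \<subseteq> P" if "x \<in> A - B" for x
    using that cT sub by (intro octad_through) (auto simp: card_insert_if)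
  then obtain P where P: "\<And>x. x \<in> A - B \<Longrightarrow> P x \<in> octads"
    "\<And>x. x \<in> A - B \<Longrightarrow> insert x T \<subseteq> P x" by metis
  have PA: "P x \<inter> A = insert x (A \<inter> B)" if x: "x \<in> A - B" for x
  proof (rule sym, rule card_seteq)
    show "insert x (A \<inter> B) \<subseteq> P x \<inter> A" using P(2)[OF x] x by (auto simp: T_def)
    have "P x \<noteq> A" using P(2)[OF x] t by (auto simp: T_def)
    then show "card (P x \<inter> A) \<le> card (insert x (A \<inter> B))"
      using octad_inter_le[OF P(1)[OF x] A] x c3 fin by simp
  qed (use fin in auto)
  have meet: "P x \<inter> Q = T" if x: "x \<in> A - B" and Q: "Q \<in> octads" "T \<subseteq> Q" "Q \<noteq> P x" for x Q
  proof (rule sym, rule card_seteq)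
    show "T \<subseteq> P x \<inter> Q" using P(2)[OF x] Q by auto
    show "card (P x \<inter> Q) \<le> card T" using octad_inter_le[OF P(1)[OF x] Q(1)] Q cT by simp
  qed (use P(1)[OF x] finite_word in \<open>auto simp: octads_def\<close>)
  have disj: "(P x - T) \<inter> (P y - T) = {}" if "x \<in> A - B" "y \<in> A - B" "x \<noteq> y" for x y
  proof -
    have "P x \<noteq> P y" using PA[OF that(1)] PA[OF that(2)] that by auto
    then show ?thesis using meet[OF that(1) P(1)[OF that(2)]] P(2)[OF that(2)] by auto
  qed
  have out: "P x - T \<subseteq> {1..24} - B" if x: "x \<in> A - B" for x
    using meet[OF x B cT(3)] P(2)[OF x] P(1)[OF x] subset_word x by (auto simp: octads_def)
  have c4: "card (P x - T) = 4" if x: "x \<in> A - B" for x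
    using P(1)[OF x] P(2)[OF x] cT by (subst card_Diff_subset) (auto simp: octads_def)
  have "card (\<Union>x\<in>A - B. P x - T) = (\<Sum>x\<in>A - B. card (P x - T))"
    using fin disj P(1) finite_word by (intro card_UN_disjoint) (auto simp: octads_def)
  also have "\<dots> = 20" using c4 AB by simp
  finally have "card (\<Union>x\<in>A - B. P x - T) = 20" .
  moreover have "card (\<Union>x\<in>A - B. P x - T) \<le> card ({1..24} - B)"
    using out by (intro card_mono) auto
  moreover have "card ({1..24} - B) = 16" using c8 sub fin by (subst card_Diff_subset) auto
  ultimately show False by simp
qed

text \<open>Reduces to intersections of size 3. An octad \<open>P\<close> through the common point
  z, two further points of \<open>A\<close> and two of \<open>B\<close> meets each of them in at
  least 3, hence exactly 4 points. Then \<open>vadd P A\<close> is an octad, and it meets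
  \<open>B\<close> in \<open>P \<inter> B\<close> without z: three points.\<close>

lemma octad_inter_ne_1:
  assumes A: "A \<in> octads" and B: "B \<in> octads"
  shows "card (A \<inter> B) \<noteq> 1"
proof
  assume c1: "card (A \<inter> B) = 1"
  then obtain z where z: "A \<inter> B = {z}" by (metis card_1_singletonE)
  have fin: "finite A" "finite B" and c8: "card A = 8" "card B = 8"
    and sub: "A \<subseteq> {1..24}" "B \<subseteq> {1..24}"
    using A B finite_word subset_word by (auto simp: octads_def)
  have AB: "card (A - B) = 7" "card (B - A) = 7"
    using c1 c8 fin by (auto simp: card_Diff_subset_Int Int_commute)
  obtain X where X: "X \<subseteq> A - B" "card X = 2"
    by (rule obtain_subset_with_card_n[of 2 "A - B"]) (simp_all add: AB(1))
  obtain Y where Y: "Y \<subseteq> B - A" "card Y = 2"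
    by (rule obtain_subset_with_card_n[of 2 "B - A"]) (simp_all add: AB(2))
  have fXY: "finite X" "finite Y" using X Y by (metis card.infinite zero_neq_numeral)+
  have zXY: "z \<notin> X" "z \<notin> Y" "X \<inter> Y = {}" using X Y z by auto
  obtain P where P: "P \<in> octads" "insert z (X \<union> Y) \<subseteq> P"
  proof -
    have "insert z (X \<union> Y) \<subseteq> {1..24}" using X Y z sub by blast
    moreover have "card (insert z (X \<union> Y)) = 5" using X Y fXY zXY by (simp add: card_Un_disjoint)
    ultimately show ?thesis using octad_through that by blast
  qed
  have fP: "finite P" and cP: "card P = 8" using P finite_word by (auto simp: octads_def)
  have four: "card (P \<inter> Q) = 4" if Q: "Q \<in> octads" "Q \<noteq> P" "insert z S \<subseteq> P \<inter> Q" "z \<notin> S" "card S = 2" for Q S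
  proof -
    have "finite S" using that by (metis card.infinite zero_neq_numeral)
    then have "3 \<le> card (P \<inter> Q)" using that fP card_mono[of "P \<inter> Q" "insert z S"] by simp
    moreover have "card (P \<inter> Q) \<le> 4" using octad_inter_le[OF P(1) Q(1)] that by auto
    ultimately show ?thesis using octad_inter_ne_3[OF P(1) Q(1)] by linarith
  qed
  have "Y \<noteq> {}" "X \<noteq> {}" using X Y by auto
  then have "A \<noteq> P" "B \<noteq> P" using P X Y by auto
  have PA: "card (P \<inter> A) = 4" using X P zXY \<open>A \<noteq> P\<close> z by (intro four[OF A, of X]) auto
  have PB: "card (P \<inter> B) = 4" using Y P zXY \<open>B \<noteq> P\<close> z by (intro four[OF B, of Y]) auto
  have "vadd P A \<in> octads"
    using card_vadd[of P A] PA fP fin cP c8 vadd_word P A by (auto simp: octads_def)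
  moreover have "card (vadd P A \<inter> B) = 3"
  proof -
    have "vadd P A \<inter> B = (P \<inter> B) - {z}" using z P by auto
    moreover have "z \<in> P \<inter> B" using z P by blast
    ultimately show ?thesis using PB by (simp add: card_Diff_singleton)
  qed
  ultimately show False using octad_inter_ne_3 B by blast
qed

section \<open>Doubly even weights, self-orthogonality and the all-one word\<close>

lemma even_octad_inter:
  assumes "A \<in> octads" "B \<in> octads"
  shows "even (card (A \<inter> B))"
proof (cases "A = B")
  case True
  then show ?thesis using assms by (simp add: octads_def)
next
  case False
  then have "card (A \<inter> B) \<in> {0, 2, 4}"
    using octad_inter_le[OF assms] octad_inter_ne_1[OF assms] octad_inter_ne_3[OF assms]
    by (auto simp: le_Suc_eq numeral_eq_Suc)
  then show ?thesis by auto
qed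

text \<open>An octad through five points of a word lowers its weight when added, so octads generate
  the code. Both claims travel together in the induction: even intersection with the added octad is
  what carries divisibility by 4 across the sum.\<close>

lemma doubly_even_aux:
  "\<alpha> \<in> G \<Longrightarrow> 4 dvd card \<alpha> \<and> (\<forall>B\<in>octads. even (card (\<alpha> \<inter> B)))"
proof (induction "card \<alpha>" arbitrary: \<alpha> rule: less_induct)
  case less
  show ?case
  proof (cases "\<alpha> = {}")
    case False
    then have "8 \<le> card \<alpha>" using min_weight less by blast
    then obtain S where S: "S \<subseteq> \<alpha>" "card S = 5"
      using obtain_subset_with_card_n[of 5 \<alpha>] by auto
    then obtain B where B: "B \<in> octads" "S \<subseteq> B"
      using octad_through[of S] subset_word less by blast
    have fin: "finite \<alpha>" "finite B" and BG: "B \<in> G" "card B = 8"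
      using less B finite_word by (auto simp: octads_def)
    have "5 \<le> card (\<alpha> \<inter> B)" using S B fin card_mono[of "\<alpha> \<inter> B" S] by auto
    then have "card (vadd \<alpha> B) < card \<alpha>" using card_vadd[OF fin] BG by linarith
    then have IH: "4 dvd card (vadd \<alpha> B)" "\<forall>C\<in>octads. even (card (vadd \<alpha> B \<inter> C))"
      using less vadd_word BG by auto
    have ev: "even (card (\<alpha> \<inter> C))" if "C \<in> octads" for C
      using IH(2) that even_octad_inter[OF B(1) that] fin even_card_vadd[of "\<alpha> \<inter> C" "B \<inter> C"]
      by (auto simp: vadd_Int)
    have "4 dvd card \<alpha>" using card_vadd[OF fin] IH(1) ev[OF B(1)] BG(2) by presburger
    then show ?thesis using ev by blast
  qed simp
qed

lemma doubly_even: "\<alpha> \<in> G \<Longrightarrow> 4 dvd card \<alpha>"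
  using doubly_even_aux by blast

lemma even_inter:
  assumes "\<alpha> \<in> G" "\<beta> \<in> G"
  shows "even (card (\<alpha> \<inter> \<beta>))"
  using card_vadd[OF assms[THEN finite_word]] assms[THEN doubly_even] doubly_even[OF vadd_word[OF assms]]
  by presburger

text \<open>A codeword nearest to the punctured all-one vector misses a set \<open>Z\<close> of at
  most 4 points, and doubly even weights leave only 0 or 4. In the latter case an octad
  \<open>Q\<close> meeting \<open>Z\<close> in exactly three points would meet the word in five,
  which is odd. To find \<open>Q\<close>, take an octad \<open>P\<close> containing \<open>Z\<close>
  and a point t, and let \<open>Q\<close> contain three points of \<open>Z\<close>, t and a point
  outside \<open>P\<close>; if \<open>Q\<close> contained all of \<open>Z\<close>, it would share
  five points with \<open>P\<close>.\<close>

lemma full_word: "{1..24} \<in> G"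
proof -
  obtain \<alpha> where a: "\<alpha> \<in> G" "card (vadd ({1..24} - {1}) \<alpha> - {1}) \<le> 3"
    using covering[of 1 "{1..24} - {1}"] by auto
  define Z where "Z = {1..24} - \<alpha>"
  have aS: "\<alpha> \<subseteq> {1..24}" and fa: "finite \<alpha>" using a subset_word finite_word by auto
  have fZ: "finite Z" by (simp add: Z_def)
  \<comment> \<open>The distance bound ignores coordinate 1, so the bound on \<open>Z\<close> is 3 +
    1.\<close>
  have "Z \<subseteq> insert 1 (vadd ({1..24} - {1}) \<alpha> - {1})" by (auto simp: Z_def)
  then have "card Z \<le> card (insert 1 (vadd ({1..24} - {1}) \<alpha> - {1}))"
    using fa by (intro card_mono) auto
  also have "\<dots> \<le> 4" using a fa by (auto simp: card_insert_if)
  finally have Z4: "card Z \<le> 4" .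
  have "card Z = 24 - card \<alpha>" "card \<alpha> \<le> 24"
    using aS fa card_mono[OF _ aS] by (auto simp: Z_def card_Diff_subset)
  then have "card Z = 0 \<or> card Z = 4" using Z4 doubly_even[OF a(1)] by presburger
  moreover have "card Z \<noteq> 4"
  proof
    assume c4: "card Z = 4"
    have ZS: "Z \<subseteq> {1..24}" by (auto simp: Z_def)
    have "card ({1..24} - Z) = 20" using c4 ZS fZ by (subst card_Diff_subset) auto
    then obtain t where t: "t \<in> {1..24} - Z" by (metis card.empty equals0I zero_neq_numeral)
    obtain P where P: "P \<in> octads" "insert t Z \<subseteq> P"
      using octad_through[of "insert t Z"] t c4 fZ ZS by auto
    have "card ({1..24} - P) = 16"
      using P subset_word finite_word by (subst card_Diff_subset) (auto simp: octads_def)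
    then obtain s where s: "s \<in> {1..24} - P" by (metis card.empty equals0I zero_neq_numeral)
    obtain W where W: "W \<subseteq> Z" "card W = 3" using obtain_subset_with_card_n[of 3 Z] c4 by auto
    have fW: "finite W" using W fZ finite_subset by blast
    have ts: "t \<noteq> s" "t \<notin> W" "s \<notin> W" using t s P W by auto
    obtain Q where Q: "Q \<in> octads" "insert s (insert t W) \<subseteq> Q"
      using octad_through[of "insert s (insert t W)"] t s ZS W fW ts by auto
    have "\<not> Z \<subseteq> Q"
      using octad_unique[OF P(1) Q(1), of "insert t Z"] P Q t s c4 fZ by auto
    then have "card (Q \<inter> Z) < card Z" using fZ by (intro psubset_card_mono) auto
    moreover have "card W \<le> card (Q \<inter> Z)" using Q W fZ by (intro card_mono) auto
    ultimately have c3: "card (Q \<inter> Z) = 3" using W c4 by simp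
    have QG: "Q \<in> G" "card Q = 8" and fQ: "finite Q" using Q finite_word by (auto simp: octads_def)
    have "Q \<inter> \<alpha> = Q - Q \<inter> Z" using subset_word[OF QG(1)] by (auto simp: Z_def)
    then have "card (Q \<inter> \<alpha>) = 5" using c3 QG fQ by (simp add: card_Diff_subset)
    then show False using even_inter[OF QG(1) a(1)] by simp
  qed
  ultimately have "Z = {}" using fZ by auto
  then have "\<alpha> = {1..24}" using aS by (auto simp: Z_def)
  then show ?thesis using a by simp
qed

end

section \<open>Kerdock sets of quadratic forms on \<open>F_2^4\<close>\<close>

type_synonym point = "bool \<times> bool \<times> bool \<times> bool"

text \<open>A constant of its own, so that polynomials over F_2 can be normalised by AC rewriting; a
  plain inequality would fall prey to the rules for negation and equality.\<close>

definition xor :: "bool \<Rightarrow> bool \<Rightarrow> bool" (infixl "\<oplus>" 65) where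
  "a \<oplus> b \<longleftrightarrow> a \<noteq> b"

lemma xor_simps [simp]:
  "a \<oplus> a = False" "a \<oplus> (a \<oplus> b) = b" "a \<oplus> False = a" "False \<oplus> a = a"
  "a \<oplus> True = (\<not> a)" "True \<oplus> a = (\<not> a)" "(\<not> a) \<oplus> b = (\<not> (a \<oplus> b))" "a \<oplus> (\<not> b) = (\<not> (a \<oplus> b))"
  by (auto simp: xor_def)

lemma xor_commute: "a \<oplus> b = b \<oplus> a"
  and xor_assoc: "(a \<oplus> b) \<oplus> c = a \<oplus> (b \<oplus> c)"
  and xor_left_commute: "a \<oplus> (b \<oplus> c) = b \<oplus> (a \<oplus> c)"
  by (auto simp: xor_def)

lemmas xor_ac = xor_commute xor_assoc xor_left_commute

lemma conj_xor: "(a \<and> (b \<oplus> c)) = ((a \<and> b) \<oplus> (a \<and> c))"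
  "((b \<oplus> c) \<and> a) = ((b \<and> a) \<oplus> (c \<and> a))"
  by (auto simp: xor_def)

lemma neg_conj_xor: "(a \<and> \<not> b) = (a \<oplus> (a \<and> b))" "(\<not> b \<and> a) = (a \<oplus> (b \<and> a))"
  by (auto simp: xor_def)

definition sdiff :: "point set \<Rightarrow> point set \<Rightarrow> point set" where
  "sdiff A B = {v. (v \<in> A) \<oplus> (v \<in> B)}"

fun affine :: "bool \<times> bool \<times> bool \<times> bool \<times> bool \<Rightarrow> point set" where
  "affine (c0, c1, c2, c3, c4) =
    {(x1, x2, x3, x4). c0 \<oplus> (c1 \<and> x1) \<oplus> (c2 \<and> x2) \<oplus> (c3 \<and> x3) \<oplus> (c4 \<and> x4)}"

text \<open>The first triple holds the coefficients of x1x2, x1x3, x1x4, that is, the first row of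
  the alternating matrix. It is kept apart because it will index the forms of a Kerdock set; the
  second triple becomes a function of it.\<close>

fun quad :: "bool \<times> bool \<times> bool \<Rightarrow> bool \<times> bool \<times> bool \<Rightarrow> point set" where
  "quad (x, y, z) (f, g, h) =
    {(x1, x2, x3, x4). (x \<and> x1 \<and> x2) \<oplus> (y \<and> x1 \<and> x3) \<oplus> (z \<and> x1 \<and> x4)
      \<oplus> (f \<and> x2 \<and> x3) \<oplus> (g \<and> x2 \<and> x4) \<oplus> (h \<and> x3 \<and> x4)}"

text \<open>The square root of the determinant of the alternating 4 x 4 matrix with these entries;
  it is 1 exactly when the form is nonsingular.\<close>

fun pfaffian :: "bool \<times> bool \<times> bool \<Rightarrow> bool \<times> bool \<times> bool \<Rightarrow> bool" where
  "pfaffian (x, y, z) (f, g, h) \<longleftrightarrow> (x \<and> h) \<oplus> (y \<and> g) \<oplus> (z \<and> f)"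

fun xor3 :: "bool \<times> bool \<times> bool \<Rightarrow> bool \<times> bool \<times> bool \<Rightarrow> bool \<times> bool \<times> bool" where
  "xor3 (x, y, z) (x', y', z') = (x \<oplus> x', y \<oplus> y', z \<oplus> z')"

text \<open>The general solution \<open>F\<close> of \<open>pfaffian (u + v) (F u + F v) = 1\<close> for \<open>u \<noteq> v\<close> with \<open>F 0 = 0\<close>;
  the free bits are read off from \<open>F (1,0,0) = (p, q, 1)\<close> and \<open>F (0,1,0) = (r, 1, 1 + q)\<close>.\<close>

fun kerdock :: "bool \<Rightarrow> bool \<Rightarrow> bool \<Rightarrow> bool \<times> bool \<times> bool \<Rightarrow> bool \<times> bool \<times> bool" where
  "kerdock p q r (x, y, z) =
    ((p \<and> x) \<oplus> (r \<and> y) \<oplus> z \<oplus> (x \<and> y),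
     (q \<and> x) \<oplus> y \<oplus> z \<oplus> (r \<and> z) \<oplus> (x \<and> z),
     x \<oplus> y \<oplus> z \<oplus> (q \<and> y) \<oplus> (p \<and> z) \<oplus> (y \<and> z))"

text \<open>Eight cosets of RM(1,4), one for each first row \<open>u\<close>; \<open>u = 0\<close>
  gives RM(1,4) itself because \<open>kerdock\<close> vanishes there.\<close>

definition kerdock_code :: "bool \<Rightarrow> bool \<Rightarrow> bool \<Rightarrow> point set set" where
  "kerdock_code p q r = {sdiff (quad u (kerdock p q r u)) (affine c) | u c. True}"

section \<open>Boolean functions evaluated at the sixteen points\<close>

definition points :: "point list" where
  "points = [(a, b, c, d). a \<leftarrow> [False, True], b \<leftarrow> [False, True], c \<leftarrow> [False, True], d \<leftarrow> [False, True]]"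

lemma length_filter_of_bool: "length (filter P xs) = (\<Sum>x\<leftarrow>xs. of_bool (P x))"
  by (induction xs) auto

lemma card_points: "card A = (\<Sum>v\<leftarrow>points. of_bool (v \<in> A))"
proof -
  have "v \<in> set points" for v by (cases v) (simp add: points_def; metis)
  then have "A = set (filter (\<lambda>v. v \<in> A) points)" by auto
  moreover have "distinct points" by (simp add: points_def)
  ultimately have "card A = length (filter (\<lambda>v. v \<in> A) points)"
    by (metis distinct_card distinct_filter)
  then show ?thesis by (simp add: length_filter_of_bool)
qed

lemma odd_of_bool_add: "odd (of_bool P + n :: nat) \<longleftrightarrow> P \<oplus> odd n"
  by (cases P) (auto simp: xor_def)

text \<open>Turns a parity check into one linear equation over F_2 in the sixteen membership
  bits.\<close>

lemma odd_card_points: "odd (card A) \<longleftrightarrow> foldr (\<lambda>v b. (v \<in> A) \<oplus> b) points False"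
  unfolding card_points by (simp add: points_def odd_of_bool_add del: even_add odd_add)

lemma xor_eq_iff: "a = (b \<oplus> c) \<longleftrightarrow> \<not> (a \<oplus> (b \<oplus> c))"
  by (auto simp: xor_def)

text \<open>The dual of RM(1,4) is RM(2,4): orthogonality to the half-spaces removes the cubic
  monomials, orthogonality to the whole space the quartic one.\<close>

lemma quad_affine_repr:
  assumes "\<And>c. even (card (A \<inter> affine c))"
  shows "\<exists>u F c. A = sdiff (quad u F) (affine c)"
proof -
  define a where "a = (\<lambda>x1 x2 x3 x4. (x1, x2, x3, x4) \<in> A)"
  have ev: "\<not> odd (card (A \<inter> affine c))" for c using assms by simp
  note E = ev[unfolded odd_card_points]
  \<comment> \<open>The check against 1 + x4 says that the coefficient of x1x2x3 is zero. The next
    three facts treat the other cubic monomials likewise, and \<open>e5\<close> uses the constant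
    1.\<close>
  have e1: "a True True True False = (a False False False False \<oplus> a True False False False \<oplus>
     a False True False False \<oplus> a False False True False \<oplus> a True True False False \<oplus> a True False True False
     \<oplus> a False True True False)"
    using E[of "(True,False,False,False,True)"]
    by (simp add: points_def a_def xor_eq_iff xor_ac)
  have e2: "a True True False True = (a False False False False \<oplus> a True False False False \<oplus>
     a False True False False \<oplus> a False False False True \<oplus> a True True False False \<oplus> a True False False True
     \<oplus> a False True False True)"
    using E[of "(True,False,False,True,False)"]
    by (simp add: points_def a_def xor_eq_iff xor_ac)
  have e3: "a True False True True = (a False False False False \<oplus> a True False False False \<oplus>
     a False False True False \<oplus> a False False False True \<oplus> a True False True False \<oplus> a True False False True
     \<oplus> a False False True True)"
    using E[of "(True,False,True,False,False)"]
    by (simp add: points_def a_def xor_eq_iff xor_ac)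
  have e4: "a False True True True = (a False False False False \<oplus> a False True False False \<oplus>
     a False False True False \<oplus> a False False False True \<oplus> a False True True False \<oplus> a False True False True
     \<oplus> a False False True True)"
    using E[of "(True,True,False,False,False)"]
    by (simp add: points_def a_def xor_eq_iff xor_ac)
  have e5: "a True True True True = (a True True True False \<oplus> a True True False True \<oplus>
     a True False True True \<oplus> a False True True True \<oplus> a False False False False \<oplus>
     a True False False False \<oplus> a False True False False \<oplus> a False False True False \<oplus> a False False False True
     \<oplus> a True True False False \<oplus> a True False True False \<oplus> a True False False True \<oplus>
     a False True True False \<oplus> a False True False True \<oplus> a False False True True)"
    using E[of "(True,False,False,False,False)"]
    by (simp add: points_def a_def xor_eq_iff xor_ac)
  \<comment> \<open>Moebius inversion: coefficients are the first and second differences of the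
    function at the origin.\<close>
  define o0 where "o0 = a False False False False"
  define l where "l = (o0, a True False False False \<oplus> o0, a False True False False \<oplus> o0,
    a False False True False \<oplus> o0, a False False False True \<oplus> o0)"
  define u where "u = (a True True False False \<oplus> a True False False False \<oplus> a False True False False \<oplus> o0,
    a True False True False \<oplus> a True False False False \<oplus> a False False True False \<oplus> o0,
    a True False False True \<oplus> a True False False False \<oplus> a False False False True \<oplus> o0)"
  define F where "F = (a False True True False \<oplus> a False True False False \<oplus> a False False True False \<oplus> o0,
    a False True False True \<oplus> a False True False False \<oplus> a False False False True \<oplus> o0,
    a False False True True \<oplus> a False False True False \<oplus> a False False False True \<oplus> o0)"
  have "a x1 x2 x3 x4 = ((x1, x2, x3, x4) \<in> sdiff (quad u F) (affine l))" for x1 x2 x3 x4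
    by (cases x1; cases x2; cases x3; cases x4;
        simp add: e5 e4 e3 e2 e1 u_def F_def l_def o0_def sdiff_def xor_ac)
  then have "A = sdiff (quad u F) (affine l)"
    unfolding a_def by (auto simp: set_eq_iff)
  then show ?thesis by blast
qed

text \<open>Meant for words with two points in the octad: minimum weight 8 leaves at least 6 points
  outside it, for the whole coset of RM(1,4).\<close>

lemma pfaffian_if_weight_ge_6:
  assumes "\<And>c. 6 \<le> card (sdiff (quad u F) (affine c))"
  shows "pfaffian u F"
proof (rule ccontr)
  assume np: "\<not> pfaffian u F"
  obtain x y z where u: "u = (x, y, z)" by (cases u)
  obtain f g h where F: "F = (f, g, h)" by (cases F)
  \<comment> \<open>A form of rank at most 2 becomes a product of two affine functions after adding \<open>affine c\<close>.\<close>
  define c where "c = (False, False, False, x \<and> y \<and> f,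
    if x then g \<and> z else if y then h \<and> z else \<not> z \<and> f \<and> g \<and> h)"
  have "card (sdiff (quad u F) (affine c)) \<le> 4"
    using np unfolding u F c_def
    by (cases x; cases y; cases z; cases f; cases g; cases h)
       (simp_all add: card_points points_def sdiff_def)
  then show False using assms[of c] by simp
qed

text \<open>The conditions are linear in \<open>F u = (f, g, h)\<close>. Adding those for
  \<open>u\<close> and \<open>u + e1\<close> cancels the products and leaves h = 1 + x + qy + pz;
  \<open>e2\<close> and \<open>e3\<close> give g and f in the same way. The term 1 in h may be
  written y + z + yz when \<open>u\<close> is neither 0 nor \<open>e1\<close>, and this form is also
  right at those two points; hence the quadratic terms of \<open>kerdock\<close>.\<close>

lemma kerdock_unique:
  assumes single: "\<And>u. u \<noteq> (False, False, False) \<Longrightarrow> pfaffian u (F u)"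
    and pair: "\<And>u v. u \<noteq> v \<Longrightarrow> u \<noteq> (False, False, False) \<Longrightarrow> v \<noteq> (False, False, False) \<Longrightarrow>
      pfaffian (xor3 u v) (xor3 (F u) (F v))"
  shows "\<exists>p q r. \<forall>u. u \<noteq> (False, False, False) \<longrightarrow> F u = kerdock p q r u"
proof -
  define e1 e2 e3 where e: "e1 = (True, False, False)" "e2 = (False, True, False)" "e3 = (False, False, True)"
  obtain p q h1 where 1: "F e1 = (p, q, h1)" by (cases "F e1")
  obtain r g2 h2 where 2: "F e2 = (r, g2, h2)" by (cases "F e2")
  obtain f3 g3 h3 where 3: "F e3 = (f3, g3, h3)" by (cases "F e3")
  have b: "h1" "g2" "f3" "h2 = (\<not> q)" "h3 = (\<not> p)" "g3 = (\<not> r)"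
    using single[of e1] single[of e2] single[of e3] pair[of e1 e2] pair[of e1 e3] pair[of e2 e3]
    unfolding 1 2 3 unfolding e by (auto simp: xor_def)
  have "F u = kerdock p q r u" if "u \<noteq> (False, False, False)" for u
  proof -
    obtain x y z where u: "u = (x, y, z)" by (cases u)
    obtain f g h where F: "F u = (f, g, h)" by (cases "F u")
    show ?thesis
    proof (cases "u \<in> {e1, e2, e3}")
      case True
      then show ?thesis using 1 2 3 b e by auto
    next
      case False
      have *: "pfaffian u (f, g, h)" "pfaffian (xor3 u e1) (xor3 (f, g, h) (p, q, True))"
        "pfaffian (xor3 u e2) (xor3 (f, g, h) (r, True, \<not> q))"
        "pfaffian (xor3 u e3) (xor3 (f, g, h) (True, \<not> r, \<not> p))"
        using single[OF that] pair[of u e1] pair[of u e2] pair[of u e3] that False b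
        by (simp_all add: F 1 2 3, simp_all add: e)
      show ?thesis
        using * False that unfolding F unfolding u e
        by (cases x; cases y; cases z) (auto simp: xor_def)
    qed
  qed
  then show ?thesis by blast
qed

section \<open>Linear maps that normalise the three parameters\<close>

definition shear :: "bool \<Rightarrow> bool \<Rightarrow> point \<Rightarrow> point" where
  "shear s t = (\<lambda>(x1, x2, x3, x4). (x1 \<oplus> (s \<and> x3) \<oplus> (t \<and> x4), x2, x3, x4))"

definition swap34 :: "point \<Rightarrow> point" where
  "swap34 = (\<lambda>(x1, x2, x3, x4). (x1, x2, x4, x3))"

lemma shear_shear [simp]: "shear s t (shear s t v) = v"
  by (cases v) (auto simp: shear_def xor_def)

lemma swap34_swap34 [simp]: "swap34 (swap34 v) = v"
  by (cases v) (simp add: swap34_def)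

lemma image_involution: "(\<And>v. f (f v) = v) \<Longrightarrow> f ` A = {v. f v \<in> A}"
  by (auto simp: image_iff) metis

lemma shear_kerdock_code_subset:
  "(`) (shear s t) ` kerdock_code p q r \<subseteq> kerdock_code (p \<oplus> s) (q \<oplus> t) r"
proof
  fix B assume "B \<in> (`) (shear s t) ` kerdock_code p q r"
  then obtain x y z c0 c1 c2 c3 c4 where B:
    "B = shear s t ` sdiff (quad (x, y, z) (kerdock p q r (x, y, z))) (affine (c0, c1, c2, c3, c4))"
    by (auto simp: kerdock_code_def)
  \<comment> \<open>Substituting x1 + s x3 + t x4 for x1 changes the quadratic part exactly as
    adding s to p and t to q does. The squares x3x3 and x4x4 are linear, whence the extra terms with
    \<open>y\<close> and \<open>z\<close>.\<close>
  have "v \<in> B \<longleftrightarrow> v \<in> sdiff (quad (x, y, z) (kerdock (p \<oplus> s) (q \<oplus> t) r (x, y, z)))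
      (affine (c0, c1, c2, c3 \<oplus> (s \<and> c1) \<oplus> (s \<and> y), c4 \<oplus> (t \<and> c1) \<oplus> (t \<and> z)))" for v
    unfolding B image_involution[OF shear_shear] mem_Collect_eq
    by (cases v) (simp add: shear_def sdiff_def conj_xor xor_ac conj_ac)
  then have "B = sdiff (quad (x, y, z) (kerdock (p \<oplus> s) (q \<oplus> t) r (x, y, z)))
      (affine (c0, c1, c2, c3 \<oplus> (s \<and> c1) \<oplus> (s \<and> y), c4 \<oplus> (t \<and> c1) \<oplus> (t \<and> z)))"
    by blast
  then show "B \<in> kerdock_code (p \<oplus> s) (q \<oplus> t) r"
    unfolding kerdock_code_def by blast
qed

lemma swap34_kerdock_code_subset:
  "(`) swap34 ` kerdock_code p q r \<subseteq> kerdock_code q p (\<not> r)"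
proof
  fix B assume "B \<in> (`) swap34 ` kerdock_code p q r"
  then obtain x y z c0 c1 c2 c3 c4 where B:
    "B = swap34 ` sdiff (quad (x, y, z) (kerdock p q r (x, y, z))) (affine (c0, c1, c2, c3, c4))"
    by (auto simp: kerdock_code_def)
  have "v \<in> B \<longleftrightarrow> v \<in> sdiff (quad (x, z, y) (kerdock q p (\<not> r) (x, z, y)))
      (affine (c0, c1, c2, c4, c3))" for v
    unfolding B image_involution[OF swap34_swap34] mem_Collect_eq
    by (cases v) (simp add: swap34_def sdiff_def neg_conj_xor conj_xor xor_ac conj_ac)
  then have "B = sdiff (quad (x, z, y) (kerdock q p (\<not> r) (x, z, y))) (affine (c0, c1, c2, c4, c3))"
    by blast
  then show "B \<in> kerdock_code q p (\<not> r)"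
    unfolding kerdock_code_def by blast
qed

lemma involution_image_eq:
  assumes "\<And>v. f (f v) = v" "(`) f ` X \<subseteq> Y" "(`) f ` Y \<subseteq> X"
  shows "(`) f ` X = Y"
proof -
  have "f ` f ` A = A" for A using assms(1) by (simp add: image_comp comp_def)
  then have "Y \<subseteq> (`) f ` X" using assms(3) by (metis imageI subset_iff)
  then show ?thesis using assms(2) by blast
qed

text \<open>The shear by p and q clears these two parameters, and swapping x3 and x4 then turns
  \<open>r\<close> off. Both maps fix the origin, e1 and e2, the only points whose places are
  prescribed.\<close>

lemma kerdock_code_normalize:
  "\<exists>f. bij f \<and> f (False, False, False, False) = (False, False, False, False)
    \<and> f (True, False, False, False) = (True, False, False, False)
    \<and> f (False, True, False, False) = (False, True, False, False)
    \<and> (`) f ` kerdock_code p q r = kerdock_code False False False"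
proof -
  have s: "(`) (shear p q) ` kerdock_code p q r = kerdock_code False False r"
    using shear_kerdock_code_subset[of p q p q r] shear_kerdock_code_subset[of p q False False r]
    by (intro involution_image_eq) auto
  have w: "(`) swap34 ` kerdock_code False False True = kerdock_code False False False"
    using swap34_kerdock_code_subset[of False False True] swap34_kerdock_code_subset[of False False False]
    by (intro involution_image_eq) auto
  have bs: "bij (shear p q)" "bij swap34"
    by (auto intro!: involuntory_imp_bij)
  show ?thesis
  proof (cases r)
    case True
    have "(`) (swap34 \<circ> shear p q) ` kerdock_code p q r = (`) swap34 ` (`) (shear p q) ` kerdock_code p q r"
      by (simp add: image_image o_def)
    then have "(`) (swap34 \<circ> shear p q) ` kerdock_code p q r = kerdock_code False False False"
      using s w True by simp
    then show ?thesis using bs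
      by (intro exI[of _ "swap34 \<circ> shear p q"]) (auto simp: bij_comp swap34_def shear_def)
  next
    case False
    then show ?thesis using bs s
      by (intro exI[of _ "shear p q"]) (auto simp: shear_def)
  qed
qed

text \<open>After deletion of the origin these hexads become the words of weight 5 through e1 and e2
  that rule out every position but e1 + e2 for a third point.\<close>

lemma kerdock_code_hexad:
  assumes "v \<notin> {(False, False, False, False), (True, False, False, False),
    (False, True, False, False), (True, True, False, False)}"
  shows "\<exists>A\<in>kerdock_code False False False. card A = 6 \<and>
    {(False, False, False, False), (True, False, False, False), (False, True, False, False), v} \<subseteq> A"
proof -
  define A where "A = (\<lambda>u c. sdiff (quad u (kerdock False False False u)) (affine c))"
  have A: "A u c \<in> kerdock_code False False False" for u c
    unfolding A_def kerdock_code_def by blast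
  let ?B = "{(False, False, False, False), (True, False, False, False), (False, True, False, False)}"
  \<comment> \<open>Each hexad adds three points to the origin, e1 and e2, and the four triples
    partition the twelve admissible \<open>v\<close>.\<close>
  define A1 A2 A3 A4 where As: "A1 = A (True, False, False) (True, False, False, True, True)"
    "A2 = A (True, False, True) (True, False, False, True, True)"
    "A3 = A (True, True, False) (True, False, False, False, True)"
    "A4 = A (True, True, True) (True, False, False, True, False)"
  have c: "card A1 = 6" "card A2 = 6" "card A3 = 6" "card A4 = 6"
    by (simp_all add: As A_def sdiff_def card_points points_def)
  have B: "?B \<subseteq> A1" "?B \<subseteq> A2" "?B \<subseteq> A3" "?B \<subseteq> A4"
    by (simp_all add: As A_def sdiff_def)
  have "v \<in> A1 \<or> v \<in> A2 \<or> v \<in> A3 \<or> v \<in> A4"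
    using assms by (cases v) (auto simp: As A_def sdiff_def xor_def)
  then obtain H where H: "H \<in> {A1, A2, A3, A4}" "v \<in> H" by blast
  have "H \<in> kerdock_code False False False" using H(1) A by (auto simp: As)
  moreover have "card H = 6" using H(1) c by auto
  moreover have "\<forall>H\<in>{A1, A2, A3, A4}. ?B \<subseteq> H" using B by simp
  then have "?B \<subseteq> H" using H(1) by blast
  ultimately show ?thesis using H(2) by (intro bexI[of _ H]) auto
qed

section \<open>Coordinates for the words disjoint from the octad\<close>

lemma inj_on_vadd: "inj_on (vadd m) S"
  by (rule inj_onI) (metis vadd_cancel(1))

text \<open>The words avoiding \<open>x\<close> form a subgroup of index at most 2: adding a word
  through \<open>x\<close> maps the others through \<open>x\<close> injectively into it.\<close>

lemma card_le_twice_avoiding: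
  assumes "finite H" and closed: "\<And>k l. k \<in> H \<Longrightarrow> l \<in> H \<Longrightarrow> vadd k l \<in> H"
  shows "card H \<le> 2 * card {k \<in> H. x \<notin> k}"
proof (cases "\<exists>m\<in>H. x \<in> m")
  case True
  then obtain m where m: "m \<in> H" "x \<in> m" by blast
  have "card {k \<in> H. x \<in> k} \<le> card {k \<in> H. x \<notin> k}"
    using assms m
    by (intro card_inj_on_le[of "vadd m"]) (auto intro: inj_on_vadd)
  moreover have "H = {k \<in> H. x \<in> k} \<union> {k \<in> H. x \<notin> k}" by blast
  then have "card H = card {k \<in> H. x \<in> k} + card {k \<in> H. x \<notin> k}"
    using \<open>finite H\<close> by (metis (no_types, lifting) card_Un_disjoint disjoint_iff finite_Un mem_Collect_eq)
  ultimately show ?thesis by simp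
next
  case False
  then have "{k \<in> H. x \<notin> k} = H" by blast
  then show ?thesis by simp
qed

context golay
begin

definition K :: "nat set set" where
  "K = {\<alpha> \<in> G. \<alpha> \<inter> {1..8} = {}}"

lemma K_subset: "k \<in> K \<Longrightarrow> k \<subseteq> {9..24}"
  using subset_word by (fastforce simp: K_def)

lemma K_code: "k \<in> K \<Longrightarrow> k \<in> G"
  by (simp add: K_def)

lemma finite_K: "finite K"
  using finite_code by (simp add: K_def)

lemma finite_K_word [simp]: "k \<in> K \<Longrightarrow> finite k"
  using finite_word K_code by blast

lemma vadd_K: "k \<in> K \<Longrightarrow> l \<in> K \<Longrightarrow> vadd k l \<in> K"
  by (auto simp: K_def vadd_word vadd_Int)

lemma full_K: "{9..24} \<in> K"
proof -
  have "vadd {1..24} {1..8} = {9..24::nat}" by auto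
  then have "{9..24} \<in> G" using vadd_word[OF full_word octad_word] by simp
  then show ?thesis by (simp add: K_def)
qed

lemma empty_K: "{} \<in> K"
  by (simp add: K_def empty_word)

definition nontrivial :: "nat set \<Rightarrow> bool" where
  "nontrivial k \<longleftrightarrow> k \<in> K \<and> k \<noteq> {} \<and> k \<noteq> {9..24}"

lemma nontrivial_avoiding: "k \<in> K \<Longrightarrow> j \<in> {9..24} \<Longrightarrow> j \<notin> k \<Longrightarrow> k \<noteq> {} \<Longrightarrow> nontrivial k"
  by (auto simp: nontrivial_def)

text \<open>Both the word and its complement in the 16 points off the octad are nonzero codewords,
  so each has weight at least 8.\<close>

lemma card_nontrivial: "nontrivial k \<Longrightarrow> card k = 8"
proof -
  assume k: "nontrivial k"
  then have kK: "k \<in> K" and ne: "k \<noteq> {}" "vadd k {9..24} \<noteq> {}" by (auto simp: nontrivial_def)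
  have "8 \<le> card k" using min_weight kK K_code ne by blast
  moreover have "8 \<le> card (vadd k {9..24})" using min_weight vadd_K[OF kK full_K] K_code ne by blast
  moreover have "k \<inter> {9..24} = k" using K_subset[OF kK] by blast
  then have "card (vadd k {9..24}) + 2 * card k = card k + 16"
    using card_vadd[of k "{9..24}"] kK by simp
  ultimately show ?thesis by linarith
qed

lemma card_inter2:
  assumes "nontrivial k" "nontrivial l" "nontrivial (vadd k l)"
  shows "card (k \<inter> l) = 4"
  using card_vadd[of k l] assms[THEN card_nontrivial] assms by (auto simp: nontrivial_def)

text \<open>Independent words modulo the all-one word intersect like hyperplanes: each further one
  halves the intersection, 8, 4, 2, 1. The step applies the previous case to \<open>k\<close> and
  \<open>vadd l m\<close> and splits by inclusion-exclusion.\<close>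

lemma card_inter3:
  assumes "nontrivial k" "nontrivial l" "nontrivial m" "nontrivial (vadd k l)"
    "nontrivial (vadd k m)" "nontrivial (vadd l m)" "nontrivial (vadd k (vadd l m))"
  shows "card (k \<inter> l \<inter> m) = 2"
proof -
  have "card (k \<inter> vadd l m) = 4" "card (k \<inter> l) = 4" "card (k \<inter> m) = 4"
    using assms by (auto intro!: card_inter2)
  moreover have "k \<inter> vadd l m = vadd (k \<inter> l) (k \<inter> m)" by auto
  moreover have "(k \<inter> l) \<inter> (k \<inter> m) = k \<inter> l \<inter> m" by blast
  moreover have "finite k" using assms by (simp add: nontrivial_def)
  ultimately show ?thesis using card_vadd[of "k \<inter> l" "k \<inter> m"] by simp
qed

lemma card_inter4:
  assumes "nontrivial k" "nontrivial l" "nontrivial m" "nontrivial n" "nontrivial (vadd k l)"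
    "nontrivial (vadd k m)" "nontrivial (vadd k n)" "nontrivial (vadd l m)" "nontrivial (vadd l n)"
    "nontrivial (vadd m n)" "nontrivial (vadd k (vadd l m))" "nontrivial (vadd k (vadd l n))"
    "nontrivial (vadd k (vadd m n))" "nontrivial (vadd l (vadd m n))"
    "nontrivial (vadd k (vadd l (vadd m n)))"
  shows "card (k \<inter> l \<inter> m \<inter> n) = 1"
proof -
  have "card (k \<inter> l \<inter> vadd m n) = 2" "card (k \<inter> l \<inter> m) = 2" "card (k \<inter> l \<inter> n) = 2"
    using assms by (auto intro!: card_inter3)
  moreover have "k \<inter> l \<inter> vadd m n = vadd (k \<inter> l \<inter> m) (k \<inter> l \<inter> n)" by auto
  moreover have "(k \<inter> l \<inter> m) \<inter> (k \<inter> l \<inter> n) = k \<inter> l \<inter> m \<inter> n" by blast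
  moreover have "finite k" using assms by (simp add: nontrivial_def)
  ultimately show ?thesis using card_vadd[of "k \<inter> l \<inter> m" "k \<inter> l \<inter> n"] by simp
qed

text \<open>Complementing within the 16 points allows the intersection counts to be used for any
  pattern of membership and non-membership.\<close>

definition flip :: "bool \<Rightarrow> nat set \<Rightarrow> nat set" where
  "flip b k = (if b then vadd {9..24} k else k)"

lemma nontrivial_flip: "nontrivial (flip b k) \<longleftrightarrow> nontrivial k"
proof -
  have "nontrivial (vadd {9..24} k)" if "nontrivial k" for k
    using that vadd_K[OF full_K] by (auto simp: nontrivial_def dest: arg_cong[of _ _ "vadd {9..24}"])
  then show ?thesis unfolding flip_def by (metis vadd_cancel(1))
qed

lemma vadd_flip: "vadd (flip a k) (flip b l) = flip (a \<noteq> b) (vadd k l)"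
  by (auto simp: flip_def)

text \<open>Words agreeing on the first seven coordinates also agree on the eighth, because their
  sum meets the octad evenly; so they differ by a word of \<open>K\<close>.\<close>

lemma fibre_card_le:
  "card {\<alpha> \<in> G. \<alpha> \<inter> {1..7} = S} \<le> card K"
proof (cases "{\<alpha> \<in> G. \<alpha> \<inter> {1..7} = S} = {}")
  case False
  then obtain \<beta> where b: "\<beta> \<in> G" "\<beta> \<inter> {1..7} = S" by blast
  have "vadd \<beta> \<alpha> \<in> K" if a: "\<alpha> \<in> G" "\<alpha> \<inter> {1..7} = S" for \<alpha>
  proof -
    have "vadd \<beta> \<alpha> \<inter> {1..8} \<subseteq> {8}"
    proof
      fix x assume x: "x \<in> vadd \<beta> \<alpha> \<inter> {1..8}"
      moreover have "x \<in> \<alpha> \<longleftrightarrow> x \<in> \<beta>" if "x \<in> {1..7}" using a(2) b(2) that by blast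
      ultimately have "x \<notin> {1..7}" "x \<in> {1..8}" by auto
      then show "x \<in> {8}" by simp
    qed
    moreover have ev: "even (card (vadd \<beta> \<alpha> \<inter> {1..8}))"
      using even_inter[OF vadd_word octad_word] a b by blast
    ultimately have "vadd \<beta> \<alpha> \<inter> {1..8} = {}"
      by (metis card_1_singleton_iff One_nat_def odd_one subset_singletonD)
    then show ?thesis using vadd_word a b by (simp add: K_def)
  qed
  then show ?thesis
    using finite_K by (intro card_inj_on_le[of "vadd \<beta>"]) (auto intro: inj_on_vadd)
qed (simp only: card.empty)

lemma sum_fibres: "(\<Sum>S\<in>Pow {1..7}. card {\<alpha> \<in> G. \<alpha> \<inter> {1..7} = S}) = 4096"
proof -
  have "(\<Sum>S\<in>Pow {1..7}. card {\<alpha> \<in> G. \<alpha> \<inter> {1..7} = S})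
      = card (\<Union>S\<in>Pow {1..7}. {\<alpha> \<in> G. \<alpha> \<inter> {1..7} = S})"
    using finite_code by (intro card_UN_disjoint[symmetric]) auto
  also have "(\<Union>S\<in>Pow {1..7}. {\<alpha> \<in> G. \<alpha> \<inter> {1..7} = S}) = G"
    by (rule subset_antisym, blast, rule subsetI, rule_tac a = "x \<inter> {1..7}" in UN_I) simp_all
  finally show ?thesis using card_code by simp
qed

lemma card_K_ge: "32 \<le> card K"
proof -
  have "(4096::nat) \<le> (\<Sum>S\<in>Pow {1..7::nat}. card K)"
    unfolding sum_fibres[symmetric] by (intro sum_mono fibre_card_le)
  also have "\<dots> = 128 * card K" by (simp add: card_Pow)
  finally show ?thesis by simp
qed

text \<open>4096 = 128 * 32 leaves no room for an empty fibre.\<close>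

lemma fibre_nonempty:
  assumes "card K \<le> 32" "S \<subseteq> {1..7}"
  shows "\<exists>\<alpha>\<in>G. \<alpha> \<inter> {1..7} = S"
proof (rule ccontr)
  assume "\<not> ?thesis"
  then have "{\<alpha> \<in> G. \<alpha> \<inter> {1..7} = S} = {}" by blast
  then have 0: "card {\<alpha> \<in> G. \<alpha> \<inter> {1..7} = S} = 0" by (simp only: card.empty)
  have "4096 = (\<Sum>S\<in>Pow {1..7} - {S}. card {\<alpha> \<in> G. \<alpha> \<inter> {1..7} = S})"
    using sum_fibres 0 assms(2) sum.remove[of "Pow {1..7}" S "\<lambda>S. card {\<alpha> \<in> G. \<alpha> \<inter> {1..7} = S}"]
    by simp
  also have "\<dots> \<le> (\<Sum>S\<in>Pow {1..7::nat} - {S}. 32)"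
    using assms(1) fibre_card_le le_trans by (intro sum_mono) blast
  also have "\<dots> = 127 * 32" using assms(2) by (simp add: card_Diff_singleton card_Pow)
  finally show False by simp
qed

text \<open>The indicators of \<open>k1\<close>, ..., \<open>k4\<close> are to be the linear
  coordinates, with 9 at the origin, \<open>p\<close> at e1 and \<open>q\<close> at e2. Avoiding 9,
  then \<open>p\<close>, then \<open>q\<close> at most halves the number of words each time, so from
  32 at least 16, 8 and 4 survive. \<open>k3\<close> and \<open>k4\<close> avoid all three points;
  \<open>k1\<close> and \<open>k2\<close> avoid 9 and exactly one of \<open>p\<close> and
  \<open>q\<close>.\<close>

lemma basis:
  assumes p: "p \<in> {10..24}" and q: "q \<in> {10..24}" and pq: "p \<noteq> q"
  obtains k1 k2 k3 k4 where "{k1, k2, k3, k4} \<subseteq> K" "9 \<notin> k1 \<union> k2 \<union> k3 \<union> k4"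
    "p \<in> k1 - (k2 \<union> k3 \<union> k4)" "q \<in> k2 - (k1 \<union> k3 \<union> k4)"
    "inj_on (\<lambda>x. (x \<in> k1, x \<in> k2, x \<in> k3, x \<in> k4)) {9..24}"
    "\<And>k. k \<in> K \<Longrightarrow> \<exists>c. \<forall>x\<in>{9..24}. x \<in> k \<longleftrightarrow> (x \<in> k1, x \<in> k2, x \<in> k3, x \<in> k4) \<in> affine c"
proof -
  define K9 where "K9 = {k \<in> K. 9 \<notin> k}"
  define Kp where "Kp = {k \<in> K9. p \<notin> k}"
  define Kq where "Kq = {k \<in> K9. q \<notin> k}"
  define Kpq where "Kpq = {k \<in> Kp. q \<notin> k}"
  note defs = K9_def Kp_def Kq_def Kpq_def
  have fin: "finite K9" "finite Kp" "finite Kq" "finite Kpq" using finite_K by (simp_all add: defs)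
  have cl9: "vadd k l \<in> K9" if "k \<in> K9" "l \<in> K9" for k l using that by (auto simp: defs vadd_K)
  have clp: "vadd k l \<in> Kp" if "k \<in> Kp" "l \<in> Kp" for k l using that by (auto simp: defs vadd_K)
  have clpq: "vadd k l \<in> Kpq" if "k \<in> Kpq" "l \<in> Kpq" for k l using that by (auto simp: defs vadd_K)
  have "card K \<le> 2 * card K9" unfolding K9_def by (rule card_le_twice_avoiding[OF finite_K vadd_K])
  then have c9: "16 \<le> card K9" using card_K_ge by simp
  have "card K9 \<le> 2 * card Kp" unfolding Kp_def by (rule card_le_twice_avoiding[OF fin(1) cl9])
  then have cp: "8 \<le> card Kp" using c9 by simp
  have "card K9 \<le> 2 * card Kq" unfolding Kq_def by (rule card_le_twice_avoiding[OF fin(1) cl9])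
  then have cq: "8 \<le> card Kq" using c9 by simp
  have "card Kp \<le> 2 * card Kpq" unfolding Kpq_def by (rule card_le_twice_avoiding[OF fin(2) clp])
  then have cpq: "4 \<le> card Kpq" using cp by simp
  have nt: "nontrivial k" if "k \<in> K9" "k \<noteq> {}" for k
    using that by (auto simp: K9_def intro: nontrivial_avoiding[of _ 9])
  have "\<not> Kpq \<subseteq> {{}}" using cpq card_mono[of "{{}}" Kpq] by auto
  then obtain k3 where k3: "k3 \<in> Kpq" "k3 \<noteq> {}" by blast
  have "\<not> Kpq \<subseteq> {{}, k3}" using cpq k3 card_mono[of "{{}, k3}" Kpq] by auto
  then obtain k4 where k4: "k4 \<in> Kpq" "k4 \<noteq> {}" "k4 \<noteq> k3" by blast
  have Kpq9: "k \<in> K9" if "k \<in> Kpq" for k using that by (simp add: defs)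
  \<comment> \<open>Complements of three independent words have two points in common, but here they
    would share 9, \<open>p\<close> and \<open>q\<close>.\<close>
  have span_pq: "Kpq \<subseteq> {{}, k3, k4, vadd k3 k4}"
  proof (rule ccontr)
    assume "\<not> ?thesis"
    then obtain k5 where k5: "k5 \<in> Kpq" "k5 \<noteq> {}" "k5 \<noteq> k3" "k5 \<noteq> k4" "k5 \<noteq> vadd k3 k4" by blast
    have ne: "vadd k3 (vadd k4 k5) \<noteq> {}" using k5 by (metis vadd_assoc vadd_eq_empty_iff)
    have "card (flip True k3 \<inter> flip True k4 \<inter> flip True k5) = 2"
      using k3 k4 k5 ne
      by (intro card_inter3)
        (simp_all only: vadd_flip nontrivial_flip, auto intro!: nt Kpq9 clpq)
    moreover have "{9, p, q} \<subseteq> flip True k3 \<inter> flip True k4 \<inter> flip True k5"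
      using k3 k4 k5 p q by (auto simp: flip_def defs)
    then have "card {9, p, q} \<le> card (flip True k3 \<inter> flip True k4 \<inter> flip True k5)"
      by (intro card_mono) (use k3 in \<open>auto simp: flip_def defs\<close>)
    moreover have "card {9, p, q} = 3" using p q pq by auto
    ultimately show False by simp
  qed
  have "card Kpq \<le> card {{}, k3, k4, vadd k3 k4}" using span_pq by (intro card_mono) auto
  also have "\<dots> \<le> 4" by (simp add: card_insert_if)
  finally have cpq4: "card Kpq \<le> 4" .
  have "\<not> Kp \<subseteq> Kpq" using cp cpq4 card_mono[OF fin(4), of Kp] by auto
  then obtain k2 where k2: "k2 \<in> Kp" "q \<in> k2" by (auto simp: Kpq_def)
  have "\<not> Kq \<subseteq> Kpq" using cq cpq4 card_mono[OF fin(4), of Kq] by auto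
  then obtain k1 where k1: "k1 \<in> Kq" "p \<in> k1" by (auto simp: Kpq_def Kp_def Kq_def)
  have mem: "p \<in> k1" "p \<notin> k2" "p \<notin> k3" "p \<notin> k4" "q \<notin> k1" "q \<in> k2" "q \<notin> k3" "q \<notin> k4"
    using k1 k2 k3 k4 by (auto simp: defs)
  have in9: "k1 \<in> K9" "k2 \<in> K9" "k3 \<in> K9" "k4 \<in> K9" using k1 k2 k3 k4 by (auto simp: defs)
  have ne34: "vadd k3 k4 \<noteq> {}" using k4 by auto
  have p_ne: "p \<in> A \<Longrightarrow> A \<noteq> {}" and q_ne: "q \<in> A \<Longrightarrow> A \<noteq> {}" for A by auto
  have inj: "inj_on (\<lambda>x. (x \<in> k1, x \<in> k2, x \<in> k3, x \<in> k4)) {9..24}"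
  proof (rule inj_onI, rule ccontr)
    fix x y assume xy: "x \<in> {9..24}" "y \<in> {9..24}" "x \<noteq> y"
      and eq: "(x \<in> k1, x \<in> k2, x \<in> k3, x \<in> k4) = (y \<in> k1, y \<in> k2, y \<in> k3, y \<in> k4)"
    \<comment> \<open>Complement each word that misses \<open>x\<close>: all four sets then contain
      \<open>x\<close>, and also \<open>y\<close> if the patterns agree, yet they meet in one
      point.\<close>
    let ?c = "\<lambda>k. flip (x \<notin> k) k"
    have "card (?c k1 \<inter> ?c k2 \<inter> ?c k3 \<inter> ?c k4) = 1"
      by (rule card_inter4; simp only: vadd_flip nontrivial_flip; rule nt)
        (simp_all add: in9 cl9 ne34 k3 k4 p_ne q_ne mem del: vadd_eq_empty_iff)
    moreover have "{x, y} \<subseteq> ?c k1 \<inter> ?c k2 \<inter> ?c k3 \<inter> ?c k4"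
      using xy eq by (auto simp: flip_def)
    then have "card {x, y} \<le> card (?c k1 \<inter> ?c k2 \<inter> ?c k3 \<inter> ?c k4)"
      using in9 by (intro card_mono) (auto simp: flip_def K9_def)
    ultimately show False using xy by simp
  qed
  have span: "\<exists>c. \<forall>x\<in>{9..24}. x \<in> k \<longleftrightarrow> (x \<in> k1, x \<in> k2, x \<in> k3, x \<in> k4) \<in> affine c" if k: "k \<in> K" for k
  proof -
    \<comment> \<open>Elimination: the memberships of 9, \<open>p\<close> and \<open>q\<close> tell
      whether to remove the all-one word, \<open>k1\<close> and \<open>k2\<close>; what remains
      avoids all three points and so lies in \<open>Kpq\<close>.\<close>
    define c0 where "c0 \<longleftrightarrow> 9 \<in> k"
    define l where "l = flip c0 k"
    define c1 c2 where "c1 \<longleftrightarrow> p \<in> l" and "c2 \<longleftrightarrow> q \<in> l"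
    have l: "l \<in> K9" using k vadd_K[OF full_K] by (auto simp: l_def flip_def c0_def K9_def)
    define m where "m = vadd (if c1 then k1 else {}) (vadd (if c2 then k2 else {}) l)"
    have e9: "{} \<in> K9" using empty_K by (simp add: K9_def)
    have "m \<in> K9" using l in9 e9 cl9 by (auto simp: m_def)
    moreover have "p \<notin> m" "q \<notin> m" using mem by (auto simp: m_def c1_def c2_def)
    ultimately have "m \<in> Kpq" by (simp add: Kpq_def Kp_def)
    then have "m \<in> {{}, k3, k4, vadd k3 k4}" using span_pq by blast
    then obtain c3 c4 where m: "m = vadd (if c3 then k3 else {}) (if c4 then k4 else {})"
      by (metis (full_types) insert_iff singletonD vadd_empty)
    have "x \<in> k \<longleftrightarrow> (x \<in> k1, x \<in> k2, x \<in> k3, x \<in> k4) \<in> affine (c0, c1, c2, c3, c4)" if "x \<in> {9..24}" for x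
    proof -
      have "x \<in> k \<longleftrightarrow> c0 \<oplus> (x \<in> l)" using that by (auto simp: l_def flip_def xor_def)
      moreover have "x \<in> l \<longleftrightarrow> (c1 \<and> x \<in> k1) \<oplus> (c2 \<and> x \<in> k2) \<oplus> (x \<in> m)"
        by (auto simp: m_def xor_def)
      moreover have "x \<in> m \<longleftrightarrow> (c3 \<and> x \<in> k3) \<oplus> (c4 \<and> x \<in> k4)"
        by (auto simp: m xor_def)
      ultimately show ?thesis by (simp add: xor_assoc)
    qed
    then show ?thesis by blast
  qed
  show thesis
  proof (rule that[OF _ _ _ _ inj span])
    show "{k1, k2, k3, k4} \<subseteq> K" "9 \<notin> k1 \<union> k2 \<union> k3 \<union> k4"
      using in9 by (auto simp: K9_def)
    show "p \<in> k1 - (k2 \<union> k3 \<union> k4)" "q \<in> k2 - (k1 \<union> k3 \<union> k4)" using mem by blast+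
  qed
qed

end

section \<open>The seven further cosets as quadratic forms\<close>

lemma affine_sdiff: "\<exists>c''. sdiff (affine c) (affine c') = affine c''"
proof -
  obtain c0 c1 c2 c3 c4 where c: "c = (c0, c1, c2, c3, c4)" by (cases c)
  obtain d0 d1 d2 d3 d4 where d: "c' = (d0, d1, d2, d3, d4)" by (cases c')
  have "sdiff (affine c) (affine c') = affine (c0 \<oplus> d0, c1 \<oplus> d1, c2 \<oplus> d2, c3 \<oplus> d3, c4 \<oplus> d4)"
    by (auto simp: c d sdiff_def conj_xor xor_ac)
  then show ?thesis by blast
qed

lemma quad_sdiff: "sdiff (quad u F) (quad u' F') = quad (xor3 u u') (xor3 F F')"
  by (cases u; cases F; cases u'; cases F') (auto simp: sdiff_def conj_xor xor_ac)

lemma sdiff_assoc: "sdiff (sdiff A B) C = sdiff A (sdiff B C)"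
  and sdiff_commute: "sdiff A B = sdiff B A"
  and sdiff_left_commute: "sdiff A (sdiff B C) = sdiff B (sdiff A C)"
  by (auto simp: sdiff_def xor_ac)

lemma sdiff_empty [simp]: "sdiff {} A = A"
  by (simp add: sdiff_def)

lemma pfaffian_nonzero: "pfaffian u F \<Longrightarrow> u \<noteq> (False, False, False)"
  by (cases F) auto

lemma xor3_self: "xor3 u u = (False, False, False)"
  by (cases u) simp

definition (in golay) nr_words :: "nat set set" where
  "nr_words = {\<alpha> \<in> G. \<alpha> \<inter> {1..8} = {} \<or> (\<exists>i\<in>{1..7}. \<alpha> \<inter> {1..8} = {i, 8})}"

locale coordinatized_golay = golay +
  fixes \<phi> :: "nat \<Rightarrow> point"
  assumes bij_coord: "bij_betw \<phi> {9..24} UNIV"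
    and coord_K: "(`) \<phi> ` K = range affine"
begin

lemma inj_coord: "inj_on \<phi> {9..24}" and surj_coord: "\<phi> ` {9..24} = UNIV"
  using bij_coord by (auto simp: bij_betw_def)

lemma coord_vadd:
  "\<phi> ` (vadd \<alpha> \<beta> \<inter> {9..24}) = sdiff (\<phi> ` (\<alpha> \<inter> {9..24})) (\<phi> ` (\<beta> \<inter> {9..24}))"
proof (rule set_eqI)
  fix v :: point
  obtain x where x: "x \<in> {9..24}" "v = \<phi> x" using surj_coord by blast
  have "\<phi> x \<in> \<phi> ` (A \<inter> {9..24}) \<longleftrightarrow> x \<in> A" for A
    using inj_on_image_mem_iff[OF inj_coord x(1), of "A \<inter> {9..24}"] x(1) by blast
  then show "v \<in> \<phi> ` (vadd \<alpha> \<beta> \<inter> {9..24}) \<longleftrightarrow> v \<in> sdiff (\<phi> ` (\<alpha> \<inter> {9..24})) (\<phi> ` (\<beta> \<inter> {9..24}))"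
    by (simp only: x(2) sdiff_def mem_Collect_eq vadd_iff xor_def)
qed

lemma card_coord: "A \<subseteq> {9..24} \<Longrightarrow> card (\<phi> ` A) = card A"
  using inj_coord by (meson card_image inj_on_subset)

lemma obtain_K:
  obtains k where "k \<in> K" "\<phi> ` (k \<inter> {9..24}) = affine c"
proof -
  have "affine c \<in> (`) \<phi> ` K" unfolding coord_K by blast
  then obtain k where k: "k \<in> K" "\<phi> ` k = affine c" by auto
  moreover have "k \<inter> {9..24} = k" using K_subset[OF k(1)] by blast
  ultimately show thesis using that by simp
qed

lemma obtain_affine:
  assumes "k \<in> K"
  obtains c where "\<phi> ` (k \<inter> {9..24}) = affine c"
proof -
  have "\<phi> ` k \<in> range affine" unfolding coord_K[symmetric] using assms by blast
  then obtain c where "\<phi> ` k = affine c" by auto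
  moreover have "k \<inter> {9..24} = k" using K_subset[OF assms] by blast
  ultimately show thesis using that by simp
qed

text \<open>There are only 32 coefficient tuples. This bound is what makes every trace on the first
  seven coordinates occur.\<close>

lemma card_K_le: "card K \<le> 32"
proof -
  have "inj_on ((`) \<phi>) K"
    using inj_on_image_Pow[OF inj_coord] K_subset by (meson Pow_iff inj_on_subset subsetI)
  then have "card K = card (range affine)" using coord_K card_image by metis
  also have "\<dots> \<le> card (UNIV :: (bool \<times> bool \<times> bool \<times> bool \<times> bool) set)" by (intro card_image_le) simp
  also have "\<dots> = 32" by (simp add: card_cartesian_product card_UNIV_bool flip: UNIV_Times_UNIV)
  finally show ?thesis .
qed

text \<open>Golay words are orthogonal to \<open>K\<close>, which has become RM(1,4).\<close>

lemma word_repr: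
  assumes a: "\<alpha> \<in> G"
  shows "\<exists>u F c. \<phi> ` (\<alpha> \<inter> {9..24}) = sdiff (quad u F) (affine c)"
proof (rule quad_affine_repr)
  fix c
  obtain k where k: "k \<in> K" "\<phi> ` (k \<inter> {9..24}) = affine c" by (rule obtain_K)
  have "\<phi> ` (\<alpha> \<inter> {9..24}) \<inter> affine c = \<phi> ` ((\<alpha> \<inter> {9..24}) \<inter> (k \<inter> {9..24}))"
    unfolding k(2)[symmetric] by (rule inj_on_image_Int[OF inj_coord, symmetric]) auto
  moreover have "(\<alpha> \<inter> {9..24}) \<inter> (k \<inter> {9..24}) = \<alpha> \<inter> k" using K_subset[OF k(1)] by blast
  moreover have "card (\<phi> ` (\<alpha> \<inter> k)) = card (\<alpha> \<inter> k)"
    by (rule card_coord) (use K_subset[OF k(1)] in blast)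
  ultimately show "even (card (\<phi> ` (\<alpha> \<inter> {9..24}) \<inter> affine c))"
    using even_inter[OF a K_code[OF k(1)]] by simp
qed

lemma word_pfaffian:
  assumes a: "\<alpha> \<in> G" "card (\<alpha> \<inter> {1..8}) = 2"
    and eq: "\<phi> ` (\<alpha> \<inter> {9..24}) = sdiff (quad u F) (affine c)"
  shows "pfaffian u F"
proof (rule pfaffian_if_weight_ge_6)
  fix c'
  obtain c'' where c'': "sdiff (affine c) (affine c') = affine c''" using affine_sdiff by blast
  obtain k where k: "k \<in> K" "\<phi> ` (k \<inter> {9..24}) = affine c''" by (rule obtain_K)
  have "sdiff A (sdiff A B) = B" for A B by (auto simp: sdiff_def)
  then have "sdiff (quad u F) (affine c') = \<phi> ` (vadd \<alpha> k \<inter> {9..24})"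
    unfolding coord_vadd eq k(2) c''[symmetric] by (simp add: sdiff_assoc)
  then have "card (sdiff (quad u F) (affine c')) = card (vadd \<alpha> k \<inter> {9..24})"
    by (simp add: card_coord)
  moreover have 8: "vadd \<alpha> k \<inter> {1..8} = \<alpha> \<inter> {1..8}" using k(1) by (simp add: vadd_Int K_def)
  have "8 \<le> card (vadd \<alpha> k)"
  proof (rule min_weight)
    show "vadd \<alpha> k \<noteq> {}" using 8 a(2) by fastforce
  qed (use a k K_code vadd_word in blast)
  moreover have "vadd \<alpha> k = (\<alpha> \<inter> {1..8}) \<union> (vadd \<alpha> k \<inter> {9..24})"
  proof -
    have "vadd \<alpha> k \<subseteq> {1..24}" using subset_word vadd_word a(1) K_code[OF k(1)] by blast
    then have "vadd \<alpha> k = (vadd \<alpha> k \<inter> {1..8}) \<union> (vadd \<alpha> k \<inter> {9..24})" by fastforce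
    then show ?thesis unfolding 8 .
  qed
  then have "card (vadd \<alpha> k) \<le> 2 + card (vadd \<alpha> k \<inter> {9..24})"
    using card_Un_le[of "\<alpha> \<inter> {1..8}" "vadd \<alpha> k \<inter> {9..24}"] a(2) by simp
  ultimately show "6 \<le> card (sdiff (quad u F) (affine c'))" by linarith
qed

text \<open>A word with trace {i} on the first seven coordinates exists, and even intersection with
  the octad forces 8 into it.\<close>

lemma octad_pair_word:
  assumes "i \<in> {1..7}"
  shows "\<exists>\<alpha>\<in>G. \<alpha> \<inter> {1..8} = {i, 8}"
proof -
  obtain \<alpha> where a: "\<alpha> \<in> G" "\<alpha> \<inter> {1..7} = {i}"
    using fibre_nonempty[OF card_K_le, of "{i}"] assms by auto
  have "{1..8} = insert 8 {1..7::nat}" by auto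
  then have "\<alpha> \<inter> {1..8} = (if 8 \<in> \<alpha> then {i, 8} else {i})" using a(2) by auto
  moreover have "even (card (\<alpha> \<inter> {1..8}))" using even_inter[OF a(1) octad_word] .
  ultimately show ?thesis using a(1) by (auto split: if_splits)
qed

text \<open>All the traces {i, 8} share the point 8, so the sum of words with traces {i, 8} and {j,
  8} meets the octad in {i, j}: differences of the forms are nonsingular too. A nonsingular form has
  a nonzero first row, so the seven rows \<open>u i\<close> are distinct and exhaust the nonzero
  triples. This makes \<open>F\<close> a function of the row, as the uniqueness of Kerdock sets
  requires.\<close>

theorem coord_nr_words:
  "\<exists>p q r. (\<lambda>\<alpha>. \<phi> ` (\<alpha> \<inter> {9..24})) ` nr_words = kerdock_code p q r"
proof -
  have "\<forall>i\<in>{1..7}. \<exists>\<alpha> u F c. \<alpha> \<in> G \<and> \<alpha> \<inter> {1..8} = {i, 8}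
      \<and> \<phi> ` (\<alpha> \<inter> {9..24}) = sdiff (quad u F) (affine c)"
    using octad_pair_word word_repr by metis
  then obtain a u F c where w: "\<And>i. i \<in> {1..7} \<Longrightarrow> a i \<in> G"
    "\<And>i. i \<in> {1..7} \<Longrightarrow> a i \<inter> {1..8} = {i, 8}"
    "\<And>i. i \<in> {1..7} \<Longrightarrow> \<phi> ` (a i \<inter> {9..24}) = sdiff (quad (u i) (F i)) (affine (c i))"
    by metis
  have single: "pfaffian (u i) (F i)" if i: "i \<in> {1..7}" for i
    by (rule word_pfaffian[OF w(1)[OF i] _ w(3)[OF i]]) (use w(2)[OF i] i in auto)
  have pair: "pfaffian (xor3 (u i) (u j)) (xor3 (F i) (F j))"
    if ij: "i \<in> {1..7}" "j \<in> {1..7}" "i \<noteq> j" for i j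
  proof -
    obtain c' where c': "sdiff (affine (c i)) (affine (c j)) = affine c'" using affine_sdiff by blast
    have "vadd (a i) (a j) \<inter> {1..8} = {i, j}" using w(2) ij by (auto simp: vadd_Int)
    then have "card (vadd (a i) (a j) \<inter> {1..8}) = 2" using ij by simp
    moreover have "\<phi> ` (vadd (a i) (a j) \<inter> {9..24})
        = sdiff (quad (xor3 (u i) (u j)) (xor3 (F i) (F j))) (affine c')"
      unfolding coord_vadd w(3)[OF ij(1)] w(3)[OF ij(2)] c'[symmetric] quad_sdiff[symmetric]
      by (simp only: sdiff_assoc sdiff_left_commute sdiff_commute)
    ultimately show ?thesis by (rule word_pfaffian[OF vadd_word[OF w(1)[OF ij(1)] w(1)[OF ij(2)]]])
  qed
  have inj: "inj_on u {1..7}"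
    using pair pfaffian_nonzero xor3_self by (metis inj_onI)
  have "card (u ` {1..7}) = card (UNIV - {(False, False, False)} :: (bool \<times> bool \<times> bool) set)"
    using card_image[OF inj]
    by (simp add: card_Diff_singleton card_cartesian_product card_UNIV_bool flip: UNIV_Times_UNIV)
  moreover have "u ` {1..7} \<subseteq> UNIV - {(False, False, False)}"
  proof
    fix v assume "v \<in> u ` {1..7}"
    then obtain i where "i \<in> {1..7}" "v = u i" by blast
    then show "v \<in> UNIV - {(False, False, False)}" using pfaffian_nonzero[OF single] by simp
  qed
  ultimately have img: "u ` {1..7} = UNIV - {(False, False, False)}"
    by (intro card_subset_eq) auto
  define ix where "ix = inv_into {1..7} u"
  have ix: "ix v \<in> {1..7}" "u (ix v) = v" if "v \<noteq> (False, False, False)" for v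
  proof -
    have "v \<in> u ` {1..7}" unfolding img using that by simp
    then show "ix v \<in> {1..7}" "u (ix v) = v" unfolding ix_def by (rule inv_into_into, rule f_inv_into_f)
  qed
  have "\<exists>p q r. \<forall>v. v \<noteq> (False, False, False) \<longrightarrow> F (ix v) = kerdock p q r v"
  proof (rule kerdock_unique)
    show "pfaffian v (F (ix v))" if "v \<noteq> (False, False, False)" for v
      using single[OF ix(1)[OF that]] ix(2)[OF that] by simp
    show "pfaffian (xor3 v v') (xor3 (F (ix v)) (F (ix v')))"
      if "v \<noteq> v'" "v \<noteq> (False, False, False)" "v' \<noteq> (False, False, False)" for v v'
      using pair[OF ix(1)[OF that(2)] ix(1)[OF that(3)]] ix(2)[OF that(2)] ix(2)[OF that(3)] that(1)
      by metis
  qed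
  then obtain p q r where F: "\<And>v. v \<noteq> (False, False, False) \<Longrightarrow> F (ix v) = kerdock p q r v"
    by blast
  have Fi: "F i = kerdock p q r (u i)" if "i \<in> {1..7}" for i
    using F[of "u i"] pfaffian_nonzero[OF single[OF that]] inj that by (simp add: ix_def)
  have zero: "quad (False, False, False) (kerdock p q r (False, False, False)) = {}" by simp
  have "(\<lambda>\<alpha>. \<phi> ` (\<alpha> \<inter> {9..24})) ` nr_words = kerdock_code p q r"
  proof (intro subset_antisym subsetI)
    fix A assume "A \<in> (\<lambda>\<alpha>. \<phi> ` (\<alpha> \<inter> {9..24})) ` nr_words"
    then obtain \<alpha> where \<alpha>: "\<alpha> \<in> nr_words" "A = \<phi> ` (\<alpha> \<inter> {9..24})" by blast
    show "A \<in> kerdock_code p q r"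
    proof (cases "\<alpha> \<inter> {1..8} = {}")
      case True
      then have "\<alpha> \<in> K" using \<alpha>(1) by (simp add: K_def nr_words_def)
      then obtain d where "A = affine d" unfolding \<alpha>(2) by (rule obtain_affine)
      then have "A = sdiff (quad (False, False, False) (kerdock p q r (False, False, False))) (affine d)"
        unfolding zero by simp
      then show ?thesis unfolding kerdock_code_def by blast
    next
      case False
      then obtain i where i: "i \<in> {1..7}" "\<alpha> \<inter> {1..8} = {i, 8}"
        using \<alpha>(1) unfolding nr_words_def by blast
      have aG: "\<alpha> \<in> G" using \<alpha>(1) by (simp add: nr_words_def)
      have "vadd \<alpha> (a i) \<in> K"
        using aG w(1)[OF i(1)] w(2)[OF i(1)] i(2) by (simp add: K_def vadd_word vadd_Int)
      then obtain d where d: "\<phi> ` (vadd \<alpha> (a i) \<inter> {9..24}) = affine d" by (rule obtain_affine)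
      obtain d' where d': "sdiff (affine (c i)) (affine d) = affine d'" using affine_sdiff by blast
      have "A = \<phi> ` (vadd (a i) (vadd \<alpha> (a i)) \<inter> {9..24})"
        unfolding \<alpha>(2) by (metis vadd_cancel(2) vadd_commute)
      also have "\<dots> = sdiff (quad (u i) (kerdock p q r (u i))) (affine d')"
        unfolding coord_vadd[of "a i"] d w(3)[OF i(1)] Fi[OF i(1)] sdiff_assoc d' ..
      finally show ?thesis unfolding kerdock_code_def by blast
    qed
  next
    fix A assume "A \<in> kerdock_code p q r"
    then obtain v d where A: "A = sdiff (quad v (kerdock p q r v)) (affine d)"
      unfolding kerdock_code_def by blast
    show "A \<in> (\<lambda>\<alpha>. \<phi> ` (\<alpha> \<inter> {9..24})) ` nr_words"
    proof (cases "v = (False, False, False)")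
      case True
      obtain k where k: "k \<in> K" "\<phi> ` (k \<inter> {9..24}) = affine d" by (rule obtain_K)
      have "A = \<phi> ` (k \<inter> {9..24})" unfolding k A True zero by simp
      moreover have "k \<in> nr_words" using k(1) by (simp add: K_def nr_words_def)
      ultimately show ?thesis by blast
    next
      case False
      define i where "i = ix v"
      have i: "i \<in> {1..7}" "u i = v" using ix[OF False] by (simp_all add: i_def)
      obtain d' where d': "sdiff (affine (c i)) (affine d) = affine d'" using affine_sdiff by blast
      obtain k where k: "k \<in> K" "\<phi> ` (k \<inter> {9..24}) = affine d'" by (rule obtain_K)
      have "sdiff B (sdiff B C) = C" for B C by (auto simp: sdiff_def)
      then have "A = \<phi> ` (vadd (a i) k \<inter> {9..24})"
        unfolding A coord_vadd k(2) w(3)[OF i(1)] Fi[OF i(1)] i(2) d'[symmetric]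
        by (simp only: sdiff_assoc)
      moreover have "vadd (a i) k \<in> nr_words"
        using i(1) w(1,2)[OF i(1)] k(1) by (auto simp: K_def nr_words_def vadd_word vadd_Int)
      ultimately show ?thesis by blast
    qed
  qed
  then show ?thesis by blast
qed

end

section \<open>A common model for the punctured codes\<close>

context golay
begin

lemma exists_coordinates:
  assumes p: "p \<in> {10..24}" and q: "q \<in> {10..24}" and pq: "p \<noteq> q"
  shows "\<exists>\<phi>. coordinatized_golay G \<phi> \<and> \<phi> 9 = (False, False, False, False)
    \<and> \<phi> p = (True, False, False, False) \<and> \<phi> q = (False, True, False, False)"
proof -
  obtain k1 k2 k3 k4 where k: "{k1, k2, k3, k4} \<subseteq> K" "9 \<notin> k1 \<union> k2 \<union> k3 \<union> k4"
    "p \<in> k1 - (k2 \<union> k3 \<union> k4)" "q \<in> k2 - (k1 \<union> k3 \<union> k4)"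
    "inj_on (\<lambda>x. (x \<in> k1, x \<in> k2, x \<in> k3, x \<in> k4)) {9..24}"
    "\<And>k. k \<in> K \<Longrightarrow> \<exists>c. \<forall>x\<in>{9..24}. x \<in> k \<longleftrightarrow> (x \<in> k1, x \<in> k2, x \<in> k3, x \<in> k4) \<in> affine c"
    by (rule basis[OF assms]) (rule that; assumption)
  define \<phi> where "\<phi> = (\<lambda>x. (x \<in> k1, x \<in> k2, x \<in> k3, x \<in> k4))"
  have inj: "inj_on \<phi> {9..24}" using k(5) by (simp add: \<phi>_def)
  have "card (\<phi> ` {9..24}) = card (UNIV :: point set)"
    using card_image[OF inj] by (simp add: card_points points_def)
  then have surj: "\<phi> ` {9..24} = UNIV" by (intro card_subset_eq) auto
  have eqI: "\<phi> ` A = B" if A: "A \<subseteq> {9..24}" "\<And>x. x \<in> {9..24} \<Longrightarrow> x \<in> A \<longleftrightarrow> \<phi> x \<in> B" for A B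
  proof (rule set_eqI)
    fix v :: point
    obtain x where x: "x \<in> {9..24}" "v = \<phi> x" using surj by blast
    show "v \<in> \<phi> ` A \<longleftrightarrow> v \<in> B"
      unfolding x(2) inj_on_image_mem_iff[OF inj x(1) A(1)] by (rule A(2)[OF x(1)])
  qed
  have "(`) \<phi> ` K = range affine"
  proof (intro subset_antisym subsetI)
    fix A assume "A \<in> (`) \<phi> ` K"
    then obtain k where kK: "k \<in> K" "A = \<phi> ` k" by blast
    obtain c where "\<forall>x\<in>{9..24}. x \<in> k \<longleftrightarrow> \<phi> x \<in> affine c" using k(6)[OF kK(1)] unfolding \<phi>_def by blast
    then have "A = affine c" unfolding kK(2) by (intro eqI[OF K_subset[OF kK(1)]]) blast
    then show "A \<in> range affine" by blast
  next
    fix A assume "A \<in> range affine"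
    then obtain c0 c1 c2 c3 c4 where A: "A = affine (c0, c1, c2, c3, c4)" by auto
    define sc where "sc = (\<lambda>b k. if b then k else {} :: nat set)"
    have sc: "sc b k \<in> K" if "k \<in> K" for b k using that empty_K by (simp add: sc_def)
    \<comment> \<open>The all-one word of the 16 points supplies the constant term.\<close>
    define k where "k = vadd (sc c0 {9..24}) (vadd (sc c1 k1) (vadd (sc c2 k2) (vadd (sc c3 k3) (sc c4 k4))))"
    have kK: "k \<in> K" unfolding k_def using k(1) full_K by (intro vadd_K sc) auto
    have "\<phi> ` k = A" unfolding A
      by (rule eqI[OF K_subset[OF kK]]) (auto simp: k_def sc_def \<phi>_def xor_def)
    then show "A \<in> (`) \<phi> ` K" using kK by blast
  qed
  then have "coordinatized_golay G \<phi>"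
    using inj surj golay_axioms by (simp add: coordinatized_golay_def coordinatized_golay_axioms_def bij_betw_def)
  moreover have "\<phi> 9 = (False, False, False, False)" "\<phi> p = (True, False, False, False)"
    "\<phi> q = (False, True, False, False)"
    using k(2-4) by (auto simp: \<phi>_def)
  ultimately show ?thesis by blast
qed

text \<open>Golay coordinate 9 is the first coordinate of \<open>NR\<close>, the deleted one; the
  two shifts, by 8 and by 1, combine to 9.\<close>

lemma PN_words: "PN G = (\<lambda>\<alpha>. (\<lambda>x. x - 9) ` (\<alpha> \<inter> {10..24})) ` nr_words"
proof -
  have words: "(\<Union>i\<in>{0..7}. D G i) = nr_words"
  proof (intro subset_antisym subsetI)
    fix \<alpha> assume "\<alpha> \<in> (\<Union>i\<in>{0..7}. D G i)"
    then show "\<alpha> \<in> nr_words" by (auto simp: D_def nr_words_def split: if_splits)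
  next
    fix \<alpha> assume "\<alpha> \<in> nr_words"
    then consider "\<alpha> \<in> D G 0" | i where "i \<in> {1..7}" "\<alpha> \<in> D G i"
      by (force simp: D_def nr_words_def)
    then show "\<alpha> \<in> (\<Union>i\<in>{0..7}. D G i)" by cases (force+)
  qed
  have shift: "(\<lambda>j. j - 1) ` ((\<lambda>j. j - 8) ` (\<alpha> \<inter> {9..24}) - {1}) = (\<lambda>x. x - 9) ` (\<alpha> \<inter> {10..24})" for \<alpha> :: "nat set"
  proof -
    have "(\<lambda>j. j - 8) ` (\<alpha> \<inter> {9..24}) - {1} = (\<lambda>j. j - 8) ` (\<alpha> \<inter> {10..24})"
      by (force simp: image_iff)
    then show ?thesis by (simp add: image_image)
  qed
  have "NR G = (\<lambda>\<alpha>. (\<lambda>j. j - 8) ` (\<alpha> \<inter> {9..24})) ` nr_words"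
    unfolding NR_def words by blast
  moreover have "PN G = (\<lambda>\<beta>. (\<lambda>j. j - 1) ` (\<beta> - {1})) ` NR G"
    unfolding PN_def by blast
  ultimately show ?thesis by (simp only: image_image[of "\<lambda>\<beta>. (\<lambda>j. j - 1) ` (\<beta> - {1})"] shift)
qed

end

definition punctured_kerdock :: "point set set" where
  "punctured_kerdock = (\<lambda>A. A - {(False, False, False, False)}) ` kerdock_code False False False"

text \<open>The model depends neither on \<open>G\<close> nor on the points, so varying
  \<open>p\<close> and \<open>q\<close> for one code already yields automorphisms that are
  2-transitive on the coordinates.\<close>

theorem PN_coordinates:
  assumes G: "golay_with_octad G" and p: "p \<in> {1..15}" and q: "q \<in> {1..15}" and pq: "p \<noteq> q"
  shows "\<exists>\<psi>. bij_betw \<psi> {1..15} (UNIV - {(False, False, False, False)})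
    \<and> \<psi> p = (True, False, False, False) \<and> \<psi> q = (False, True, False, False)
    \<and> (`) \<psi> ` PN G = punctured_kerdock"
proof -
  interpret golay G by unfold_locales (rule G)
  let ?o = "(False, False, False, False)"
  obtain \<phi> where c: "coordinatized_golay G \<phi>" "\<phi> 9 = ?o"
    "\<phi> (p + 9) = (True, False, False, False)" "\<phi> (q + 9) = (False, True, False, False)"
    using exists_coordinates[of "p + 9" "q + 9"] p q pq by auto
  interpret coordinatized_golay G \<phi> by (rule c(1))
  obtain s t r where C: "(\<lambda>\<alpha>. \<phi> ` (\<alpha> \<inter> {9..24})) ` nr_words = kerdock_code s t r"
    using coord_nr_words by blast
  obtain f where f: "bij f" "f ?o = ?o" "f (True, False, False, False) = (True, False, False, False)"
    "f (False, True, False, False) = (False, True, False, False)"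
    "(`) f ` kerdock_code s t r = kerdock_code False False False"
    using kerdock_code_normalize by blast
  define \<psi> where "\<psi> = (\<lambda>x. f (\<phi> (x + 9)))"
  have inj: "inj_on (f \<circ> \<phi>) {9..24}"
    using inj_coord f(1) by (metis comp_inj_on bij_is_inj inj_on_subset subset_UNIV)
  have surj: "(f \<circ> \<phi>) ` {9..24} = UNIV"
    using surj_coord f(1) by (metis image_comp bij_is_surj)
  have "bij_betw (f \<circ> \<phi>) ({9..24} - {9}) (UNIV - {?o})"
    using inj surj f(2) c(2) by (intro bij_betw_DiffI) (auto simp: bij_betw_def)
  moreover have "bij_betw (\<lambda>x. x + 9) {1..15::nat} ({9..24} - {9})"
    by (rule bij_betw_byWitness[of _ "\<lambda>x. x - 9"]) auto
  ultimately have bij: "bij_betw \<psi> {1..15} (UNIV - {?o})"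
    using bij_betw_trans by (fastforce simp: \<psi>_def comp_def)
  have word: "\<psi> ` (\<lambda>x. x - 9) ` (\<alpha> \<inter> {10..24}) = f ` \<phi> ` (\<alpha> \<inter> {9..24}) - {?o}" for \<alpha>
  proof -
    have "\<psi> ` (\<lambda>x. x - 9) ` (\<alpha> \<inter> {10..24}) = (f \<circ> \<phi>) ` (\<alpha> \<inter> {10..24})"
      by (auto simp: \<psi>_def image_image intro!: image_cong)
    also have "\<dots> = (f \<circ> \<phi>) ` ((\<alpha> \<inter> {9..24}) - {9})"
      by (rule arg_cong[of _ _ "(`) (f \<circ> \<phi>)"]) auto
    also have "\<dots> = (f \<circ> \<phi>) ` (\<alpha> \<inter> {9..24}) - (f \<circ> \<phi>) ` {9}"
      by (rule inj_on_image_set_diff[OF inj]) auto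
    also have "\<dots> = f ` \<phi> ` (\<alpha> \<inter> {9..24}) - {?o}" using f(2) c(2) by (simp add: image_comp)
    finally show ?thesis .
  qed
  have "(`) \<psi> ` PN G = (\<lambda>\<alpha>. \<psi> ` (\<lambda>x. x - 9) ` (\<alpha> \<inter> {10..24})) ` nr_words"
    unfolding PN_words by (rule image_image)
  also have "\<dots> = (\<lambda>A. A - {?o}) ` (`) f ` (\<lambda>\<alpha>. \<phi> ` (\<alpha> \<inter> {9..24})) ` nr_words"
    by (simp only: word, simp only: image_image)
  also have "\<dots> = punctured_kerdock"
    unfolding C f(5) punctured_kerdock_def ..
  finally have "(`) \<psi> ` PN G = punctured_kerdock" .
  then show ?thesis using bij f c by (intro exI[of _ \<psi>]) (simp add: \<psi>_def)
qed

section \<open>Transitivity\<close>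

lemma golay_with_octad_permuted:
  assumes G: "golay_with_octad G" and \<pi>: "\<pi> permutes {1..8}"
  shows "golay_with_octad ((`) \<pi> ` G)"
proof -
  interpret golay G by unfold_locales (rule G)
  have inj: "inj \<pi>" using \<pi> permutes_inj by blast
  have "\<pi> permutes {1..24}" using \<pi> by (rule permutes_subset) auto
  then have 24: "\<pi> ` \<alpha> \<subseteq> {1..24}" if "\<alpha> \<in> G" for \<alpha>
    using subset_word[OF that] permutes_image by blast
  have vadd: "vadd (\<pi> ` \<alpha>) (\<pi> ` \<beta>) = \<pi> ` vadd \<alpha> \<beta>" for \<alpha> \<beta>
    using image_vadd[OF inj] by simp
  have "linear_code 24 ((`) \<pi> ` G)"
    using 24 empty_word vadd_word by (auto simp: linear_code_def vecs_def vadd)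
  moreover have "card ((`) \<pi> ` G) = 2 ^ 12"
    using card_image[OF inj_on_subset[OF inj_on_image_Pow[OF inj]], of G] card_code by simp
  moreover have "card ` ((`) \<pi> ` G - {{}}) = card ` (G - {{}})"
  proof -
    have "(`) \<pi> ` G - {{}} = (`) \<pi> ` (G - {{}})" by blast
    moreover have "card (\<pi> ` \<alpha>) = card \<alpha>" for \<alpha>
      using inj by (meson card_image inj_on_subset subset_UNIV)
    ultimately show ?thesis by (simp add: image_image)
  qed
  moreover have "{1..8} \<in> (`) \<pi> ` G"
    using octad_word permutes_image[OF \<pi>] by (metis imageI)
  ultimately show ?thesis using G by (simp add: golay_with_octad_def)
qed

text \<open>Adding a word with octad trace {i, 8} exchanges the traces {} and {i, 8} but turns {j,
  8} into {i, j}. Interchanging i and 8 repairs this without touching a coordinate of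
  \<open>PN\<close>, at the price of replacing the Golay code by its image.\<close>

lemma PN_translate:
  assumes G: "golay_with_octad G" and c: "c \<in> PN G"
  shows "\<exists>G'. golay_with_octad G' \<and> PN G' = vadd c ` PN G"
proof -
  interpret golay G by unfold_locales (rule G)
  define sh where "sh = (\<lambda>\<alpha>. (\<lambda>x. x - 9) ` (\<alpha> \<inter> {10..24::nat}))"
  have sh_vadd: "sh (vadd \<alpha> \<beta>) = vadd (sh \<alpha>) (sh \<beta>)" for \<alpha> \<beta>
    unfolding sh_def vadd_Int by (rule image_vadd[of _ "{10..24}"]) (auto simp: inj_on_def)
  have PN: "PN G = sh ` nr_words" using PN_words by (simp add: sh_def)
  obtain \<alpha>0 where \<alpha>0: "\<alpha>0 \<in> nr_words" "c = sh \<alpha>0" using c unfolding PN by blast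
  \<comment> \<open>The value 8 encodes a word off the octad; the transposition is then the
    identity.\<close>
  obtain i where i: "i \<in> {1..8}" "\<alpha>0 \<inter> {1..8} = (if i = 8 then {} else {i, 8})"
  proof (cases "\<alpha>0 \<inter> {1..8} = {}")
    case True
    then show ?thesis using that[of 8] by simp
  next
    case False
    then obtain j where "j \<in> {1..7}" "\<alpha>0 \<inter> {1..8} = {j, 8}" using \<alpha>0(1) unfolding nr_words_def by blast
    then show ?thesis using that[of j] by simp
  qed
  define \<pi> where "\<pi> = transpose i (8::nat)"
  have \<pi>: "\<pi> permutes {1..8}" unfolding \<pi>_def using i(1) by (intro permutes_swap_id) auto
  have \<pi>\<pi>: "\<pi> ` \<pi> ` A = A" for A by (simp add: \<pi>_def image_image)
  have golay': "golay_with_octad ((`) \<pi> ` G)" by (rule golay_with_octad_permuted[OF G \<pi>])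
  interpret G': golay "(`) \<pi> ` G" by unfold_locales (rule golay')
  have \<pi>_oct: "\<pi> ` A \<inter> {1..8} = \<pi> ` (A \<inter> {1..8})" for A
    using permutes_image[OF \<pi>] permutes_inj[OF \<pi>] by (metis image_Int)
  have sh_\<pi>: "sh (\<pi> ` A) = sh A" for A
  proof -
    have "\<pi> ` A \<inter> {10..24} = A \<inter> {10..24}"
      using i(1) by (auto simp: \<pi>_def transpose_def image_iff split: if_splits)
    then show ?thesis by (simp add: sh_def)
  qed
  have key: "\<pi> ` vadd \<alpha>0 \<alpha> \<in> G'.nr_words \<longleftrightarrow> \<alpha> \<in> nr_words" if "\<alpha> \<in> G" for \<alpha>
  proof -
    define S0 where "S0 = \<alpha>0 \<inter> {1..8}"
    define P where "P = (\<lambda>X. X = {} \<or> (\<exists>j\<in>{1..7}. X = {j, 8::nat}))"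
    define f where "f = (\<lambda>X. \<pi> ` vadd S0 X)"
    have Pf: "P (f X)" if PX: "P X" for X
    proof (cases "i = 8")
      case True
      then show ?thesis using PX i(2) by (simp add: f_def S0_def \<pi>_def)
    next
      case False
      then have i7: "i \<in> {1..7}" and S0: "S0 = {i, 8}" using i by (auto simp: S0_def)
      consider "X = {}" | "X = {i, 8}" | j where "j \<in> {1..7}" "j \<noteq> i" "X = {j, 8}"
        using PX unfolding P_def by blast
      then show ?thesis
      proof cases
        case 1
        then have "f X = {i, 8}" by (auto simp: f_def S0 \<pi>_def)
        then show ?thesis using i7 unfolding P_def by blast
      next
        case 2
        then show ?thesis by (simp add: f_def S0 P_def)
      next
        case (3 j)
        then have "vadd S0 X = {i, j}" using i7 by (auto simp: S0)
        then have "f X = {j, 8}" using 3 by (auto simp: f_def \<pi>_def transpose_def)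
        then show ?thesis using 3(1) unfolding P_def by blast
      qed
    qed
    \<comment> \<open>Since \<open>\<pi>\<close> fixes the trace \<open>S0\<close>, \<open>f\<close>
      is an involution, so preserving \<open>P\<close> in one direction suffices.\<close>
    have "\<pi> ` S0 = S0" using i(2) by (auto simp: S0_def \<pi>_def split: if_splits)
    moreover have "\<pi> ` vadd A B = vadd (\<pi> ` A) (\<pi> ` B)" for A B
      using image_vadd[OF permutes_inj[OF \<pi>]] by simp
    ultimately have "f (f X) = X" for X by (simp add: f_def \<pi>\<pi>)
    then have "P (f X) \<longleftrightarrow> P X" for X using Pf by metis
    moreover have "\<pi> ` vadd \<alpha>0 \<alpha> \<inter> {1..8} = f (\<alpha> \<inter> {1..8})"
      unfolding \<pi>_oct vadd_Int by (simp add: f_def S0_def)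
    moreover have "vadd \<alpha>0 \<alpha> \<in> G" using vadd_word that \<alpha>0(1) by (simp add: nr_words_def)
    moreover have "\<beta> \<in> nr_words \<longleftrightarrow> \<beta> \<in> G \<and> P (\<beta> \<inter> {1..8})" for \<beta>
      unfolding nr_words_def P_def by blast
    moreover have "\<beta> \<in> G'.nr_words \<longleftrightarrow> \<beta> \<in> (`) \<pi> ` G \<and> P (\<beta> \<inter> {1..8})" for \<beta>
      unfolding G'.nr_words_def P_def by blast
    ultimately show ?thesis using that by simp
  qed
  have "G'.nr_words = (\<lambda>\<alpha>. \<pi> ` vadd \<alpha>0 \<alpha>) ` nr_words"
  proof (intro subset_antisym subsetI)
    fix \<beta> assume b: "\<beta> \<in> G'.nr_words"
    then obtain \<gamma> where \<gamma>: "\<gamma> \<in> G" "\<beta> = \<pi> ` \<gamma>" by (auto simp: G'.nr_words_def)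
    have "\<beta> = \<pi> ` vadd \<alpha>0 (vadd \<alpha>0 \<gamma>)" using \<gamma> by simp
    moreover have "vadd \<alpha>0 \<gamma> \<in> G" using vadd_word \<gamma> \<alpha>0 by (simp add: nr_words_def)
    ultimately show "\<beta> \<in> (\<lambda>\<alpha>. \<pi> ` vadd \<alpha>0 \<alpha>) ` nr_words" using key b by blast
  next
    fix \<beta> assume "\<beta> \<in> (\<lambda>\<alpha>. \<pi> ` vadd \<alpha>0 \<alpha>) ` nr_words"
    then show "\<beta> \<in> G'.nr_words" using key by (auto simp: nr_words_def)
  qed
  then have "PN ((`) \<pi> ` G) = vadd c ` PN G"
    unfolding PN G'.PN_words sh_def[symmetric] \<alpha>0(2) by (simp add: image_image sh_\<pi> sh_vadd)
  then show ?thesis using golay' by blast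
qed

section \<open>Distances to the code and standard positions of vectors\<close>

lemma PN_subset: "PN G \<subseteq> Pow {1..15}"
  unfolding PN_def NR_def by force

lemma finite_PN: "finite (PN G)"
  using PN_subset finite_subset by blast

lemma empty_PN:
  assumes "golay_with_octad G"
  shows "{} \<in> PN G"
proof -
  interpret golay G by unfold_locales (rule assms)
  have "{} \<in> nr_words" by (simp add: nr_words_def empty_word)
  then show ?thesis unfolding PN_words by force
qed

lemma dist_to_code_le: "finite C \<Longrightarrow> c \<in> C \<Longrightarrow> dist_to_code C \<gamma> \<le> card (vadd \<gamma> c)"
  unfolding dist_to_code_def hdist_def by (intro Min_le) auto

lemma dist_to_code_attained:
  assumes "finite C" "C \<noteq> {}"
  obtains c where "c \<in> C" "dist_to_code C \<gamma> = card (vadd \<gamma> c)"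
proof -
  have "dist_to_code C \<gamma> \<in> hdist \<gamma> ` C"
    unfolding dist_to_code_def using assms by (intro Min_in) auto
  then show thesis using that by (auto simp: hdist_def)
qed

lemma dist_to_code_translate: "dist_to_code (vadd c ` C) (vadd c \<gamma>) = dist_to_code C \<gamma>"
proof -
  have "vadd (vadd c \<gamma>) (vadd c x) = vadd \<gamma> x" for x by auto
  then show ?thesis by (simp add: dist_to_code_def hdist_def image_image)
qed

lemma dist_to_code_image:
  assumes "inj \<sigma>"
  shows "dist_to_code ((`) \<sigma> ` C) (\<sigma> ` \<gamma>) = dist_to_code C \<gamma>"
proof -
  have "card (vadd (\<sigma> ` \<gamma>) (\<sigma> ` x)) = card (vadd \<gamma> x)" for x
    using image_vadd[OF assms, of \<gamma> x] assms by (metis card_image inj_on_subset subset_UNIV)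
  then show ?thesis by (simp add: dist_to_code_def hdist_def image_image)
qed

text \<open>For \<open>i = 3\<close> this is a line of PG(3,2).\<close>

definition standard_vector :: "nat \<Rightarrow> point set" where
  "standard_vector i = set (take i [(True, False, False, False), (False, True, False, False), (True, True, False, False)])"

text \<open>Two points of \<open>y\<close> can be sent to e1 and e2. A third point not sent to e1 +
  e2 would lie with them in a codeword of weight 5; adding that word changes the weight of
  \<open>y\<close> by at most 5 - 6, so 0 would not be a nearest codeword.\<close>

lemma standard_position:
  assumes G: "golay_with_octad G" and y: "y \<subseteq> {1..15}" and d: "dist_to_code (PN G) y = card y"
  shows "card y \<le> 3 \<and> (\<exists>\<psi>. bij_betw \<psi> {1..15} (UNIV - {(False, False, False, False)})
    \<and> (`) \<psi> ` PN G = punctured_kerdock \<and> \<psi> ` y = standard_vector (card y))"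
proof -
  have fy: "finite y" using y finite_subset by blast
  \<comment> \<open>If \<open>y\<close> has fewer than two points, the missing ones are arbitrary
    fillers.\<close>
  obtain p q where pq: "p \<in> {1..15}" "q \<in> {1..15}" "p \<noteq> q" "y \<subseteq> {} \<or> y = {p} \<or> {p, q} \<subseteq> y"
  proof (cases "card y \<le> 1")
    case True
    then consider "y = {}" | p where "y = {p}" using fy by (metis card_1_singletonE card_0_eq le_Suc_eq le_zero_eq One_nat_def)
    then show thesis
    proof cases
      case 1
      then show ?thesis using that[of 1 2] by simp
    next
      case (2 p)
      then show ?thesis using that[of p "if p = 1 then 2 else 1"] y by auto
    qed
  next
    case False
    then obtain T where "T \<subseteq> y" "card T = 2" using obtain_subset_with_card_n[of 2 y] by auto
    then obtain p q where "{p, q} \<subseteq> y" "p \<noteq> q" by (metis card_2_iff)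
    moreover have "p \<in> {1..15}" "q \<in> {1..15}" using calculation(1) y by blast+
    ultimately show ?thesis using that[of p q] by blast
  qed
  obtain \<psi> where \<psi>: "bij_betw \<psi> {1..15} (UNIV - {(False, False, False, False)})"
    "\<psi> p = (True, False, False, False)" "\<psi> q = (False, True, False, False)"
    "(`) \<psi> ` PN G = punctured_kerdock"
    using PN_coordinates[OF G pq(1-3)] by blast
  have inj: "inj_on \<psi> {1..15}" using \<psi>(1) by (simp add: bij_betw_def)
  have third: "\<psi> r = (True, True, False, False)" if r: "r \<in> y - {p, q}" and pqy: "{p, q} \<subseteq> y" for r
  proof (rule ccontr)
    assume ne: "\<psi> r \<noteq> (True, True, False, False)"
    have r15: "r \<in> {1..15}" using r y by blast
    have "\<psi> r \<noteq> \<psi> p" "\<psi> r \<noteq> \<psi> q" using inj r r15 pq(1,2) by (auto dest: inj_onD)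
    moreover have "\<psi> r \<noteq> (False, False, False, False)" using bij_betwE[OF \<psi>(1)] r15 by blast
    ultimately obtain A where A: "A \<in> kerdock_code False False False" "card A = 6"
      "{(False, False, False, False), (True, False, False, False), (False, True, False, False), \<psi> r} \<subseteq> A"
      using kerdock_code_hexad[of "\<psi> r"] ne \<psi>(2,3) by auto
    have "A - {(False, False, False, False)} \<in> (`) \<psi> ` PN G"
      unfolding \<psi>(4) punctured_kerdock_def using A(1) by blast
    then obtain c where c: "c \<in> PN G" "\<psi> ` c = A - {(False, False, False, False)}" by auto
    have c15: "c \<subseteq> {1..15}" using c(1) PN_subset by blast
    then have fc: "finite c" using finite_subset by blast
    have "card c = card (\<psi> ` c)" using inj c15 by (metis card_image inj_on_subset)
    then have c5: "card c = 5" using c(2) A(2,3) by (simp add: card_Diff_singleton)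
    have "x \<in> c" if "x \<in> {p, q, r}" for x
    proof -
      have "\<psi> x \<in> \<psi> ` c" unfolding c(2) using that A(3) \<psi>(2,3) \<open>\<psi> r \<noteq> (False, False, False, False)\<close> by auto
      then show ?thesis using inj_on_image_mem_iff[OF inj _ c15] that pq(1,2) r15 by blast
    qed
    then have "{p, q, r} \<subseteq> y \<inter> c" using r pqy by blast
    then have "card {p, q, r} \<le> card (y \<inter> c)" using fy by (intro card_mono) auto
    moreover have "card {p, q, r} = 3" using r pq(3) by auto
    ultimately have "card (vadd y c) < card y" using card_vadd[OF fy fc] c5 by linarith
    then show False using dist_to_code_le[OF finite_PN c(1), of y] d by simp
  qed
  have "card y \<le> 3 \<and> \<psi> ` y = standard_vector (card y)"
  proof (cases "{p, q} \<subseteq> y")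
    case True
    have "card (y - {p, q}) \<le> 1"
    proof (rule ccontr)
      assume "\<not> ?thesis"
      then obtain r s where rs: "r \<in> y - {p, q}" "s \<in> y - {p, q}" "r \<noteq> s"
        by (metis card_le_Suc0_iff_eq fy finite_Diff One_nat_def)
      then have "\<psi> r = \<psi> s" using third True by metis
      then show False using inj rs y by (metis DiffD1 inj_onD subsetD)
    qed
    then consider "y - {p, q} = {}" | r where "y - {p, q} = {r}"
      using fy by (metis card_1_singletonE card_0_eq finite_Diff le_Suc_eq le_zero_eq One_nat_def)
    then show ?thesis
    proof cases
      case 1
      then have y: "y = {p, q}" using True by blast
      then have "card y = 2" using pq(3) by simp
      then show ?thesis using y \<psi>(2,3) by (simp add: standard_vector_def numeral_eq_Suc)
    next
      case (2 r)
      then have y: "y = {p, q, r}" and r: "r \<in> y - {p, q}" using True by blast+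
      then have "card y = 3" using pq(3) by simp
      moreover have "\<psi> r = (True, True, False, False)" using third[OF r True] .
      ultimately show ?thesis using y \<psi>(2,3) by (simp add: standard_vector_def numeral_eq_Suc)
    qed
  next
    case False
    then consider "y = {}" | "y = {p}" using pq(4) by blast
    then show ?thesis using \<psi>(2) by cases (simp_all add: standard_vector_def)
  qed
  then show ?thesis using \<psi> by blast
qed

text \<open>Both codes go to the same model and both vectors to the same standard vector, so one
  coordinate map followed by the inverse of the other does it, extended by the identity.\<close>

lemma PN_equivalent:
  assumes "golay_with_octad G" "golay_with_octad G'" "y \<subseteq> {1..15}" "y' \<subseteq> {1..15}"
    "dist_to_code (PN G) y = card y" "dist_to_code (PN G') y' = card y'" "card y = card y'"
  shows "\<exists>\<sigma>. \<sigma> permutes {1..15} \<and> \<sigma> ` y = y' \<and> (`) \<sigma> ` PN G = PN G'"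
proof -
  let ?V = "UNIV - {(False, False, False, False)} :: point set"
  obtain \<psi> where \<psi>: "bij_betw \<psi> {1..15} ?V" "(`) \<psi> ` PN G = punctured_kerdock" "\<psi> ` y = standard_vector (card y)"
    using standard_position[OF assms(1,3,5)] by blast
  obtain \<psi>' where \<psi>': "bij_betw \<psi>' {1..15} ?V" "(`) \<psi>' ` PN G' = punctured_kerdock" "\<psi>' ` y' = standard_vector (card y')"
    using standard_position[OF assms(2,4,6)] by blast
  define \<sigma> where "\<sigma> = (\<lambda>x. if x \<in> {1..15} then inv_into {1..15} \<psi>' (\<psi> x) else x)"
  have "bij_betw (inv_into {1..15} \<psi>' \<circ> \<psi>) {1..15} {1..15}"
    using \<psi>(1) bij_betw_inv_into[OF \<psi>'(1)] by (rule bij_betw_trans)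
  then have "bij_betw \<sigma> {1..15} {1..15}"
    by (rule bij_betw_cong[THEN iffD1, rotated]) (simp add: \<sigma>_def)
  then have perm: "\<sigma> permutes {1..15}" by (rule bij_imp_permutes) (simp only: \<sigma>_def if_False)
  have im: "\<sigma> ` A = inv_into {1..15} \<psi>' ` \<psi> ` A" if "A \<subseteq> {1..15}" for A
    using that unfolding image_image by (intro image_cong) (auto simp: \<sigma>_def)
  have inv: "inv_into {1..15} \<psi>' ` \<psi>' ` A = A" if "A \<subseteq> {1..15}" for A
    using that \<psi>'(1) by (simp add: bij_betw_def inv_into_image_cancel)
  have "\<sigma> ` y = y'" using im[OF assms(3)] inv[OF assms(4)] \<psi>(3) \<psi>'(3) assms(7) by simp
  moreover have "(`) \<sigma> ` PN G = PN G'"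
  proof -
    have "(`) \<sigma> ` PN G = (`) (inv_into {1..15} \<psi>') ` (`) \<psi> ` PN G"
      unfolding image_image[of "(`) (inv_into {1..15} \<psi>')"] 
      by (intro image_cong refl im) (use PN_subset in blast)
    also have "\<dots> = (`) (inv_into {1..15} \<psi>') ` (`) \<psi>' ` PN G'" using \<psi>(2) \<psi>'(2) by simp
    also have "\<dots> = (\<lambda>A. A) ` PN G'"
      unfolding image_image[of "(`) (inv_into {1..15} \<psi>')"] 
      by (intro image_cong refl inv) (use PN_subset in blast)
    finally show ?thesis by simp
  qed
  ultimately show ?thesis using perm by blast
qed

lemma dist_part_PN_subset_orbit:
  assumes G: "golay_with_octad G" and \<gamma>: "\<gamma> \<in> dist_part 15 (PN G) i" and \<gamma>': "\<gamma>' \<in> dist_part 15 (PN G) i"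
  shows "\<gamma>' \<in> orbit_of (Aut_code 15 (PN G)) \<gamma>"
proof -
  have ne: "PN G \<noteq> {}" using empty_PN[OF G] by blast
  have v: "\<gamma> \<subseteq> {1..15}" "\<gamma>' \<subseteq> {1..15}" "dist_to_code (PN G) \<gamma> = i" "dist_to_code (PN G) \<gamma>' = i"
    using \<gamma> \<gamma>' by (auto simp: dist_part_def vecs_def)
  obtain c where c: "c \<in> PN G" "dist_to_code (PN G) \<gamma> = card (vadd \<gamma> c)"
    by (rule dist_to_code_attained[OF finite_PN ne])
  obtain c' where c': "c' \<in> PN G" "dist_to_code (PN G) \<gamma>' = card (vadd \<gamma>' c')"
    by (rule dist_to_code_attained[OF finite_PN ne])
  obtain H where H: "golay_with_octad H" "PN H = vadd c ` PN G" using PN_translate[OF G c(1)] by blast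
  obtain H' where H': "golay_with_octad H'" "PN H' = vadd c' ` PN G" using PN_translate[OF G c'(1)] by blast
  have sub: "c \<subseteq> {1..15}" "c' \<subseteq> {1..15}" using c c' PN_subset by blast+
  have "\<exists>\<sigma>. \<sigma> permutes {1..15} \<and> \<sigma> ` vadd c \<gamma> = vadd c' \<gamma>' \<and> (`) \<sigma> ` PN H = PN H'"
  proof (rule PN_equivalent[OF H(1) H'(1)])
    show "vadd c \<gamma> \<subseteq> {1..15}" "vadd c' \<gamma>' \<subseteq> {1..15}" using v sub unfolding vadd_def by blast+
    show "dist_to_code (PN H) (vadd c \<gamma>) = card (vadd c \<gamma>)" "dist_to_code (PN H') (vadd c' \<gamma>') = card (vadd c' \<gamma>')"
      "card (vadd c \<gamma>) = card (vadd c' \<gamma>')"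
      using c(2) c'(2) v(3,4) unfolding H(2) H'(2) dist_to_code_translate by (simp_all add: vadd_commute)
  qed
  then obtain \<sigma> where \<sigma>: "\<sigma> permutes {1..15}" "\<sigma> ` vadd c \<gamma> = vadd c' \<gamma>'" "(`) \<sigma> ` PN H = PN H'" by blast
  have vadd_\<sigma>: "\<sigma> ` vadd A B = vadd (\<sigma> ` A) (\<sigma> ` B)" for A B
    using image_vadd[OF permutes_inj[OF \<sigma>(1)]] by simp
  \<comment> \<open>Chosen so that the automorphism translates by \<open>c\<close>, permutes by
    \<open>\<sigma>\<close> and translates back by \<open>c'\<close>.\<close>
  define t where "t = vadd (\<sigma> ` c) c'"
  have act: "aut_act (\<sigma>, t) x = vadd c' (\<sigma> ` vadd c x)" for x
    unfolding aut_act_def t_def vadd_\<sigma> by auto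
  have "\<sigma> ` c \<subseteq> {1..15}" using sub(1) permutes_image[OF \<sigma>(1)] by blast
  then have "t \<subseteq> {1..15}" using sub(2) unfolding t_def vadd_def by blast
  moreover have "aut_act (\<sigma>, t) ` PN G = PN G"
  proof -
    have "aut_act (\<sigma>, t) ` PN G = vadd c' ` (`) \<sigma> ` vadd c ` PN G"
      unfolding act image_image ..
    also have "\<dots> = PN G" unfolding H(2)[symmetric] \<sigma>(3) H'(2) by (simp add: image_image)
    finally show ?thesis .
  qed
  ultimately have "(\<sigma>, t) \<in> Aut_code 15 (PN G)"
    using \<sigma>(1) by (simp add: Aut_code_def Aut_Hamming_def vecs_def)
  moreover have "aut_act (\<sigma>, t) \<gamma> = \<gamma>'" unfolding act \<sigma>(2) by simp
  ultimately show ?thesis unfolding orbit_of_def by blast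
qed

lemma dist_to_code_aut:
  assumes "g \<in> Aut_code n C"
  shows "dist_to_code C (aut_act g \<gamma>) = dist_to_code C \<gamma>"
proof -
  obtain \<sigma> t where g: "g = (\<sigma>, t)" by (cases g)
  have "\<sigma> permutes {1..n}" and C: "aut_act g ` C = C"
    using assms by (auto simp: Aut_code_def Aut_Hamming_def g)
  then have inj: "inj \<sigma>" using permutes_inj by blast
  have act: "aut_act g x = vadd t (\<sigma> ` x)" for x by (simp add: aut_act_def g vadd_commute)
  have "dist_to_code C (aut_act g \<gamma>) = dist_to_code (vadd t ` (`) \<sigma> ` C) (vadd t (\<sigma> ` \<gamma>))"
    using C by (simp add: act image_image)
  then show ?thesis by (simp only: dist_to_code_translate dist_to_code_image[OF inj])
qed

text \<open>Every vector on a shortest path from a vector at maximal distance to a nearest codeword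
  \<open>c\<close> still has \<open>c\<close> as a nearest codeword, so all smaller distances
  occur.\<close>

lemma dist_part_nonempty:
  assumes C: "C \<subseteq> vecs n" "C \<noteq> {}" and i: "i \<le> covering_radius n C"
  shows "dist_part n C i \<noteq> {}"
proof -
  have fv: "finite (vecs n)" by (simp add: vecs_def)
  have fC: "finite C" using C(1) fv finite_subset by blast
  have "covering_radius n C \<in> dist_to_code C ` vecs n"
    unfolding covering_radius_def using fv by (intro Max_in) (auto simp: vecs_def)
  then obtain x where x: "x \<in> vecs n" "i \<le> dist_to_code C x" using i by auto
  obtain c where c: "c \<in> C" "dist_to_code C x = card (vadd x c)"
    by (rule dist_to_code_attained[OF fC C(2)])
  obtain z where z: "z \<subseteq> vadd x c" "card z = i" using x(2) c(2) obtain_subset_with_card_n by metis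
  have sub: "x \<subseteq> {1..n}" "c \<subseteq> {1..n}" using x c C(1) by (auto simp: vecs_def)
  have fin: "finite (vadd x c)" "finite z" using sub z(1) finite_subset
    by (meson finite_vadd finite_atLeastAtMost)+
  have zn: "vadd c z \<subseteq> {1..n}" using sub z(1) by (auto simp: vadd_def)
  have "dist_to_code C (vadd c z) = i"
  proof (rule antisym)
    show "dist_to_code C (vadd c z) \<le> i"
      using dist_to_code_le[OF fC c(1), of "vadd c z"] z(2) by (simp add: vadd_commute)
    obtain d where d: "d \<in> C" "dist_to_code C (vadd c z) = card (vadd (vadd c z) d)"
      by (rule dist_to_code_attained[OF fC C(2)])
    have fd: "finite (vadd (vadd c z) d)"
      using d(1) C(1) sub fin(2) by (auto simp: vecs_def intro: finite_subset)
    have "card (vadd x c) \<le> card (vadd x d)" using dist_to_code_le[OF fC d(1), of x] c(2) by simp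
    \<comment> \<open>Triangle inequality through \<open>vadd c z\<close>: a codeword closer than
      \<open>i\<close> to it would be closer to \<open>x\<close> than \<open>c\<close> is.\<close>
    also have "vadd x d = vadd (vadd x c - z) (vadd (vadd c z) d)" using z(1) by auto
    also have "card \<dots> \<le> card (vadd x c - z) + card (vadd (vadd c z) d)"
      using fin fd by (intro card_vadd_le) auto
    also have "card (vadd x c - z) = card (vadd x c) - i"
      using z fin by (simp add: card_Diff_subset)
    finally show "i \<le> dist_to_code C (vadd c z)"
      using d(2) x(2) c(2) by linarith
  qed
  then have "vadd c z \<in> dist_part n C i" using zn by (simp add: dist_part_def vecs_def)
  then show ?thesis by blast
qed

theorem theorem3p4:
  fixes G :: "nat set set"
  assumes "golay_with_octad G"
  shows "completely_transitive 15 (Aut_code 15 (PN G)) (PN G)"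
  unfolding completely_transitive_def
proof (intro allI impI)
  fix i assume "i \<le> covering_radius 15 (PN G)"
  then have "dist_part 15 (PN G) i \<noteq> {}"
    using PN_subset empty_PN[OF assms] by (intro dist_part_nonempty) (auto simp: vecs_def)
  then obtain \<gamma> where \<gamma>: "\<gamma> \<in> dist_part 15 (PN G) i" by blast
  have "orbit_of (Aut_code 15 (PN G)) \<gamma> \<subseteq> dist_part 15 (PN G) i"
  proof
    fix \<delta> assume "\<delta> \<in> orbit_of (Aut_code 15 (PN G)) \<gamma>"
    then obtain g where g: "g \<in> Aut_code 15 (PN G)" "\<delta> = aut_act g \<gamma>" by (auto simp: orbit_of_def)
    obtain \<sigma> t where st: "g = (\<sigma>, t)" "\<sigma> permutes {1..15}" "t \<subseteq> {1..15}"
      using g(1) by (auto simp: Aut_code_def Aut_Hamming_def vecs_def)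
    have "\<sigma> ` \<gamma> \<subseteq> {1..15}"
      using \<gamma> permutes_image[OF st(2)] by (auto simp: dist_part_def vecs_def)
    then have "\<delta> \<in> vecs 15" using st by (auto simp: g(2) aut_act_def vecs_def vadd_def)
    then show "\<delta> \<in> dist_part 15 (PN G) i"
      using \<gamma> dist_to_code_aut[OF g(1)] g(2) by (simp add: dist_part_def)
  qed
  moreover have "dist_part 15 (PN G) i \<subseteq> orbit_of (Aut_code 15 (PN G)) \<gamma>"
    using dist_part_PN_subset_orbit[OF assms \<gamma>] by blast
  ultimately show "\<exists>\<gamma>\<in>vecs 15. dist_part 15 (PN G) i = orbit_of (Aut_code 15 (PN G)) \<gamma>"
    using \<gamma> by (auto simp: dist_part_def intro!: bexI[of _ \<gamma>])
qed

end
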